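(* Let $r_1,r_2\ge 2$ and $t_1,t_2\ge 3$. For $i=1,2$, let $G_i$ be an $r_i$-regular graph of order $p_i$ that admits a local antimagic $t_i$-coloring $f_i$, with $G_1,G_2$ vertex-disjoint and $r_1+p_2=r_2+p_1=r$, so that $G=G_1\vee G_2$ is $r$-regular. Suppose $p_1\equiv p_2\pmod 2$ and that for all $u\in V(G_1)$ and $v\in V(G_2)$, $$f_2^+(v)-f_1^+(u)\ne \frac{(p_2-p_1)(p_1p_2+1)}{2}+(r_1-r_2)p_1p_2-\frac{p_1r_1r_2}{2}.$$ Then $\chi_{la}(G)\le t_1+t_2$, with equality if $\chi(G_i)=t_i$ for $i=1,2$.
   Context: For a simple graph with $q$ edges, a bijection $f:E\to\{1,\dots,q\}$ is a local antimagic labeling if $f^+(u)\neq f^+(v)$ for every edge $uv$, where $f^+(u)=\sum_{e\ni u} f(e)$; if $f^+$ takes exactly $t$ distinct values, $f$ is a local antimagic $t$-coloring. $\chi_{la}$ is the minimum number of distinct values of $f^+$ over all local antimagic labelings; $\chi$ is the chromatic number. The join $G_1\vee G_2$ of vertex-disjoint graphs has vertex set $V(G_1)\cup V(G_2)$ and edge set $E(G_1)\cup E(G_2)\cup\{uv:u\in V(G_1),v\in V(G_2)\}$. *)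

theory Defs
  imports "HOL-Number_Theory.Cong" "HOL-Library.Extended_Nat"
begin

record 'a graph =
  verts :: "'a set"
  edges :: "'a set set"

definition simple_graph :: "'a graph \<Rightarrow> bool" where
  "simple_graph G \<longleftrightarrow>
     finite (verts G) \<and> (\<forall>e\<in>edges G. e \<subseteq> verts G \<and> card e = 2)"

definition degree :: "'a graph \<Rightarrow> 'a \<Rightarrow> nat" where
  "degree G v = card {e \<in> edges G. v \<in> e}"

definition regular_graph :: "'a graph \<Rightarrow> nat \<Rightarrow> bool" where
  "regular_graph G r \<longleftrightarrow> (\<forall>v\<in>verts G. degree G v = r)"

definition join :: "'a graph \<Rightarrow> 'a graph \<Rightarrow> 'a graph"  (infixl \<open>\<or>\<^sub>G\<close> 65) where
  "G \<or>\<^sub>G H = \<lparr>verts = verts G \<union> verts H,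
              edges = edges G \<union> edges H \<union> {{u, v} | u v. u \<in> verts G \<and> v \<in> verts H}\<rparr>"

definition proper_coloring :: "'a graph \<Rightarrow> ('a \<Rightarrow> nat) \<Rightarrow> bool" where
  "proper_coloring G c \<longleftrightarrow> (\<forall>u v. {u, v} \<in> edges G \<longrightarrow> c u \<noteq> c v)"

definition chromatic_number :: "'a graph \<Rightarrow> nat"  (\<open>\<chi>\<close>) where
  "\<chi> G = (LEAST k. \<exists>c. proper_coloring G c \<and> c ` verts G \<subseteq> {..<k})"

definition vertex_sum :: "'a graph \<Rightarrow> ('a set \<Rightarrow> nat) \<Rightarrow> 'a \<Rightarrow> nat" where
  "vertex_sum G f u = (\<Sum>e | e \<in> edges G \<and> u \<in> e. f e)"

definition local_antimagic_labeling :: "'a graph \<Rightarrow> ('a set \<Rightarrow> nat) \<Rightarrow> bool" where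
  "local_antimagic_labeling G f \<longleftrightarrow>
     bij_betw f (edges G) {1..card (edges G)} \<and>
     (\<forall>u v. {u, v} \<in> edges G \<longrightarrow> vertex_sum G f u \<noteq> vertex_sum G f v)"

definition num_colors :: "'a graph \<Rightarrow> ('a set \<Rightarrow> nat) \<Rightarrow> nat" where
  "num_colors G f = card (vertex_sum G f ` verts G)"

definition local_antimagic_coloring :: "'a graph \<Rightarrow> nat \<Rightarrow> ('a set \<Rightarrow> nat) \<Rightarrow> bool" where
  "local_antimagic_coloring G t f \<longleftrightarrow> local_antimagic_labeling G f \<and> num_colors G f = t"

text \<open>
  The value is \<open>\<infinity>\<close> if \<open>G\<close> has no local antimagic labeling at all (for instance if it has a
  component with a single edge), so a finite upper bound asserts that a labeling exists.
\<close>
definition local_antimagic_chromatic_number :: "'a graph \<Rightarrow> enat"  (\<open>\<chi>\<^sub>l\<^sub>a\<close>) where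
  "\<chi>\<^sub>l\<^sub>a G = (INF f\<in>{f. local_antimagic_labeling G f}. enat (num_colors G f))"

lemma simple_graph_join:
  assumes "simple_graph G" "simple_graph H" "verts G \<inter> verts H = {}"
  shows "simple_graph (G \<or>\<^sub>G H)"
proof -
  have "card {u, v} = 2" if "u \<in> verts G" "v \<in> verts H" for u v
    using assms(3) that by (cases "u = v") auto
  then show ?thesis
    using assms by (auto simp: simple_graph_def join_def)
qed

lemma degree_join:
  assumes G: "simple_graph G" and H: "simple_graph H"
    and disj: "verts G \<inter> verts H = {}" and v: "v \<in> verts G"
  shows "degree (G \<or>\<^sub>G H) v = degree G v + card (verts H)"
proof -
  have fin: "finite (edges G)" "finite (verts H)"
    using G H finite_subset[of "edges G" "Pow (verts G)"] by (auto simp: simple_graph_def)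
  have "{e \<in> edges (G \<or>\<^sub>G H). v \<in> e} = {e \<in> edges G. v \<in> e} \<union> (\<lambda>w. {v, w}) ` verts H"
    using H disj v by (auto simp: join_def simple_graph_def)
  moreover have "{e \<in> edges G. v \<in> e} \<inter> (\<lambda>w. {v, w}) ` verts H = {}"
    using G disj by (fastforce simp: simple_graph_def)
  moreover have "inj_on (\<lambda>w. {v, w}) (verts H)"
    by (auto simp: inj_on_def doubleton_eq_iff)
  ultimately show ?thesis
    using fin by (simp add: degree_def card_Un_disjoint card_image)
qed

lemma join_commute: "G \<or>\<^sub>G H = H \<or>\<^sub>G G"
  by (auto simp: join_def insert_commute)

lemma regular_join:
  assumes "simple_graph G" "simple_graph H" "verts G \<inter> verts H = {}"
    and "regular_graph G r\<^sub>1" "regular_graph H r\<^sub>2"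
    and "r\<^sub>1 + card (verts H) = r" "r\<^sub>2 + card (verts G) = r"
  shows "regular_graph (G \<or>\<^sub>G H) r"
  unfolding regular_graph_def
proof
  fix v assume "v \<in> verts (G \<or>\<^sub>G H)"
  then consider "v \<in> verts G" | "v \<in> verts H" by (auto simp: join_def)
  then show "degree (G \<or>\<^sub>G H) v = r"
  proof cases
    case 1
    then show ?thesis using assms degree_join[of G H v] by (simp add: regular_graph_def)
  next
    case 2
    then show ?thesis using assms degree_join[of H G v]
      by (simp add: regular_graph_def join_commute[of G] Int_commute)
  qed
qed

end

theory Submission
  imports Defs "HOL-Library.Disjoint_Sets"
begin

text \<open>
  The join edges are labelled \<open>1, \<dots>, p\<^sub>1 p\<^sub>2\<close> by a magic rectangle, and the labels of \<open>G\<^sub>1\<close>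
  and then of \<open>G\<^sub>2\<close> are shifted above them. As both graphs are regular, the vertex sums in each \<open>G\<^sub>i\<close>
  all change by the same amount, and the excluded value of \<open>f\<^sub>2\<^sup>+(v) - f\<^sub>1\<^sup>+(u)\<close> is the one for which
  the new sums at \<open>u\<close> and \<open>v\<close> coincide. For the lower bound, the vertex sums of any labeling colour the
  two sides of the join properly and with disjoint palettes.

  It remains to see that an \<open>m \<times> n\<close> magic rectangle exists when \<open>m, n \<ge> 3\<close> have the same parity.
  After centring the entries, this asks for an array with vanishing row and column sums on the set
  \<open>\<plusminus>A\<close>, where \<open>A\<close> is an interval. Such arrays can be juxtaposed, so it suffices to cut the rectangle
  into blocks and \<open>A\<close> into pieces that fill them: four equally spaced numbers fill a \<open>4 \<times> 2\<close> block
  because \<open>w - (w + e) - (w + 2e) + (w + 3e) = 0\<close>, and a triple \<open>{d, s, s + d}\<close> fills a \<open>3 \<times> 2\<close> block.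
  When \<open>m\<close> and \<open>n\<close> are odd, the small numbers serve as the differences \<open>d\<close> of triples, the pairs
  \<open>{s, s + d}\<close> being nested concentrically in two adjacent intervals.
\<close>

section \<open>Arrays with vanishing column sums\<close>

text \<open>Row sums remain a parameter while column sums vanish: the odd construction starts from
  pieces whose row sums are non-zero and cancel only after juxtaposition.\<close>

definition array_on :: "nat \<Rightarrow> nat \<Rightarrow> int set \<Rightarrow> (nat \<Rightarrow> int) \<Rightarrow> bool" where
  "array_on m n S \<rho> \<longleftrightarrow> (\<exists>v. bij_betw (\<lambda>(i, j). v i j) ({..<m} \<times> {..<n}) S \<and>
     (\<forall>i<m. (\<Sum>j<n. v i j) = \<rho> i) \<and> (\<forall>j<n. (\<Sum>i<m. v i j) = 0))"

abbreviation balanced :: "nat \<Rightarrow> nat \<Rightarrow> int set \<Rightarrow> bool" where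
  "balanced m n S \<equiv> array_on m n S (\<lambda>_. 0)"

definition pm :: "int set \<Rightarrow> int set" where
  "pm A = A \<union> uminus ` A"

lemma array_on_cong:
  assumes "array_on m n S \<rho>" "\<And>i. i < m \<Longrightarrow> \<rho> i = \<rho>' i"
  shows "array_on m n S \<rho>'"
  using assms by (auto simp: array_on_def)

lemma sum_lessThan_add:
  fixes f :: "nat \<Rightarrow> 'b::comm_monoid_add"
  shows "(\<Sum>j<n + k. f j) = (\<Sum>j<n. f j) + (\<Sum>j<k. f (n + j))"
  by (induction k) (auto simp: ac_simps)

lemma array_on_append:
  assumes "array_on m n S \<rho>" "array_on m k T \<sigma>" "S \<inter> T = {}"
  shows "array_on m (n + k) (S \<union> T) (\<lambda>i. \<rho> i + \<sigma> i)"
proof -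
  obtain v where v: "bij_betw (\<lambda>(i, j). v i j) ({..<m} \<times> {..<n}) S"
    "\<forall>i<m. (\<Sum>j<n. v i j) = \<rho> i" "\<forall>j<n. (\<Sum>i<m. v i j) = 0"
    using assms(1) by (auto simp: array_on_def)
  obtain w where w: "bij_betw (\<lambda>(i, j). w i j) ({..<m} \<times> {..<k}) T"
    "\<forall>i<m. (\<Sum>j<k. w i j) = \<sigma> i" "\<forall>j<k. (\<Sum>i<m. w i j) = 0"
    using assms(2) by (auto simp: array_on_def)
  define u where "u i j = (if j < n then v i j else w i (j - n))" for i j
  have "bij_betw (\<lambda>(i, j). u i j) ({..<m} \<times> {..<n}) S"
    using v(1) by (rule bij_betw_cong[THEN iffD1, rotated]) (auto simp: u_def)
  moreover have "bij_betw (\<lambda>(i, j). u i j) ({..<m} \<times> {n..<n + k}) T"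
  proof -
    have "bij_betw (\<lambda>(i, j). (i, j - n)) ({..<m} \<times> {n..<n + k}) ({..<m} \<times> {..<k})"
      by (rule bij_betw_byWitness[where f' = "\<lambda>(i, j). (i, j + n)"]) auto
    from bij_betw_trans[OF this w(1)] show ?thesis
      by (rule bij_betw_cong[THEN iffD1, rotated]) (auto simp: u_def)
  qed
  ultimately have "bij_betw (\<lambda>(i, j). u i j)
      ({..<m} \<times> {..<n} \<union> {..<m} \<times> {n..<n + k}) (S \<union> T)"
    using assms(3) by (rule bij_betw_combine)
  moreover have "{..<m} \<times> {..<n} \<union> {..<m} \<times> {n..<n + k} = {..<m} \<times> {..<n + k}"
    by auto
  ultimately have "bij_betw (\<lambda>(i, j). u i j) ({..<m} \<times> {..<n + k}) (S \<union> T)"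
    by simp
  moreover have "(\<Sum>j<n + k. u i j) = \<rho> i + \<sigma> i" if "i < m" for i
    using v w that by (simp add: sum_lessThan_add u_def)
  moreover have "(\<Sum>i<m. u i j) = 0" if "j < n + k" for j
    using v(3) w(3) that by (cases "j < n") (auto simp: u_def)
  ultimately show ?thesis
    unfolding array_on_def by blast
qed

lemma balanced_transpose:
  assumes "balanced m n S"
  shows "balanced n m S"
proof -
  obtain v where v: "bij_betw (\<lambda>(i, j). v i j) ({..<m} \<times> {..<n}) S"
    "\<forall>i<m. (\<Sum>j<n. v i j) = 0" "\<forall>j<n. (\<Sum>i<m. v i j) = 0"
    using assms by (auto simp: array_on_def)
  have "bij_betw prod.swap ({..<n} \<times> {..<m}) ({..<m} \<times> {..<n})"
    by (rule bij_betw_byWitness[where f' = prod.swap]) auto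
  from bij_betw_trans[OF this v(1)]
  have "bij_betw (\<lambda>(i, j). v j i) ({..<n} \<times> {..<m}) S"
    by (rule bij_betw_cong[THEN iffD1, rotated]) auto
  then show ?thesis
    using v(2,3) unfolding array_on_def by (intro exI[of _ "\<lambda>i j. v j i"]) simp
qed

lemma balanced_append:
  assumes "balanced m n S" "balanced m k T" "S \<inter> T = {}"
  shows "balanced m (n + k) (S \<union> T)"
  using array_on_append[OF assms] by simp

lemma balanced_stack:
  assumes "balanced m n S" "balanced k n T" "S \<inter> T = {}"
  shows "balanced (m + k) n (S \<union> T)"
  by (rule balanced_transpose[OF balanced_append[OF assms(1,2)[THEN balanced_transpose] assms(3)]])

lemma balanced_empty: "balanced m 0 {}"
  by (simp add: array_on_def bij_betw_def)

lemma balanced_UN: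
  assumes "finite I" "\<And>i. i \<in> I \<Longrightarrow> balanced m w (S i)" "disjoint_family_on S I"
  shows "balanced m (card I * w) (\<Union>i\<in>I. S i)"
  using assms
proof (induction I rule: finite_induct)
  case empty
  then show ?case by (simp add: balanced_empty)
next
  case (insert x F)
  have "S x \<inter> (\<Union>i\<in>F. S i) = {}"
    using insert.hyps insert.prems(2) by (fastforce simp: disjoint_family_on_def)
  moreover have "disjoint_family_on S F"
    using insert.prems(2) by (auto simp: disjoint_family_on_def)
  ultimately show ?case
    using insert balanced_append[of m w "S x" "card F * w" "\<Union>i\<in>F. S i"] by simp
qed

lemma balanced_scale:
  assumes "balanced m n S" "c \<noteq> 0"
  shows "balanced m n ((*) c ` S)"
proof -
  obtain v where v: "bij_betw (\<lambda>(i, j). v i j) ({..<m} \<times> {..<n}) S"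
    "\<forall>i<m. (\<Sum>j<n. v i j) = 0" "\<forall>j<n. (\<Sum>i<m. v i j) = 0"
    using assms by (auto simp: array_on_def)
  have "bij_betw ((*) c) S ((*) c ` S)"
    using assms(2) by (auto simp: bij_betw_def inj_on_def)
  from bij_betw_trans[OF v(1) this]
  have "bij_betw (\<lambda>(i, j). c * v i j) ({..<m} \<times> {..<n}) ((*) c ` S)"
    by (rule bij_betw_cong[THEN iffD1, rotated]) auto
  moreover have "(\<Sum>j<n. c * v i j) = 0" if "i < m" for i
    using v(2) that by (simp flip: sum_distrib_left)
  moreover have "(\<Sum>i<m. c * v i j) = 0" if "j < n" for j
    using v(3) that by (simp flip: sum_distrib_left)
  ultimately show ?thesis
    unfolding array_on_def by blast
qed

text \<open>Reduces an explicit matrix to finite checks. Distinctness of the listed entries gives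
  \<open>card S = m * n\<close>, and a surjection between finite sets of equal size is
  injective.\<close>

lemma array_on_matrix:
  assumes "length xss = m" "\<forall>xs\<in>set xss. length xs = n"
    and "distinct (concat xss)" "set (concat xss) = S"
    and "\<forall>i<m. (\<Sum>j<n. xss ! i ! j) = \<rho> i" "\<forall>j<n. (\<Sum>i<m. xss ! i ! j) = 0"
  shows "array_on m n S \<rho>"
proof -
  let ?f = "\<lambda>(i, j). xss ! i ! j"
  have img: "?f ` ({..<m} \<times> {..<n}) = S"
  proof
    have "xss ! i ! j \<in> S" if "i < m" "j < n" for i j
    proof -
      have "xss ! i \<in> set xss" using assms(1) that by simp
      moreover from this have "xss ! i ! j \<in> set (xss ! i)" using assms(2) that by simp
      ultimately show ?thesis using assms(4) by auto
    qed
    then show "?f ` ({..<m} \<times> {..<n}) \<subseteq> S" by auto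
    show "S \<subseteq> ?f ` ({..<m} \<times> {..<n})"
    proof
      fix x assume "x \<in> S"
      then obtain xs where xs: "xs \<in> set xss" "x \<in> set xs" using assms(4) by auto
      then obtain i j where "i < m" "xss ! i = xs" "j < n" "xs ! j = x"
        using assms(1,2) by (metis in_set_conv_nth)
      then show "x \<in> ?f ` ({..<m} \<times> {..<n})" by force
    qed
  qed
  have "length (concat xss) = m * n"
    using assms(1,2) by (induction xss arbitrary: m) auto
  then have "card S = m * n"
    using distinct_card[OF assms(3)] assms(4) by simp
  then have "inj_on ?f ({..<m} \<times> {..<n})"
    by (intro eq_card_imp_inj_on) (auto simp: img)
  then have "bij_betw ?f ({..<m} \<times> {..<n}) S"
    using img by (simp add: bij_betw_def)
  then show ?thesis
    unfolding array_on_def using assms(5,6) by (intro exI[of _ "\<lambda>i j. xss ! i ! j"]) simp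
qed

section \<open>Symmetric sets and the small blocks that fill them\<close>

lemma pm_Un: "pm (A \<union> B) = pm A \<union> pm B"
  by (auto simp: pm_def)

lemma pm_UN: "pm (\<Union>i\<in>I. A i) = (\<Union>i\<in>I. pm (A i))"
  by (auto simp: pm_def)

text \<open>Membership in a symmetric set depends only on the absolute value, so disjointness need
  only be shown for the positive halves.\<close>

lemma pm_abs:
  assumes "A \<subseteq> {0<..}"
  shows "x \<in> pm A \<longleftrightarrow> \<bar>x\<bar> \<in> A"
proof (cases "0 \<le> x")
  case True
  then have "x \<notin> uminus ` A" using assms by force
  then show ?thesis using True by (simp add: pm_def)
next
  case False
  then have "x \<notin> A" using assms by force
  moreover have "x \<in> uminus ` A \<longleftrightarrow> - x \<in> A" by force
  ultimately show ?thesis using False by (simp add: pm_def)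
qed

lemma pm_disjoint:
  assumes "A \<inter> B = {}" "A \<subseteq> {0<..}" "B \<subseteq> {0<..}"
  shows "pm A \<inter> pm B = {}"
  using assms by (auto simp: pm_abs)

text \<open>A signed list stands next to its negative: the rows \<open>x, - x\<close> cancel at
  once, and both columns cancel because the list sums to zero. The signs in \<open>xs\<close> choose
  the linear relation among the absolute values.\<close>

lemma balanced_pair:
  assumes "distinct (map abs xs)" "0 \<notin> set xs" "sum_list xs = 0"
  shows "balanced (length xs) 2 (pm (abs ` set xs))"
proof (rule array_on_matrix[of "map (\<lambda>x. [x, - x]) xs"])
  have "distinct (concat (map (\<lambda>x. [x, - x]) xs))"
    using assms(1,2)
  proof (induction xs)
    case (Cons x xs)
    have "y \<noteq> x \<and> y \<noteq> - x" if "y \<in> set xs" for y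
      using that Cons.prems(1) by (metis abs_minus_cancel distinct.simps(2) image_eqI list.set_map list.simps(9))
    then show ?case using Cons by force
  qed simp
  then show "distinct (concat (map (\<lambda>x. [x, - x]) xs))" .
  show "set (concat (map (\<lambda>x. [x, - x]) xs)) = pm (abs ` set xs)"
  proof (induction xs)
    case (Cons x xs)
    then show ?case by (auto simp: pm_def abs_if)
  qed (simp add: pm_def)
  show "\<forall>j<2. (\<Sum>i<length xs. map (\<lambda>x. [x, - x]) xs ! i ! j) = 0"
    using assms(3) by (auto simp: less_2_cases_iff sum_negf sum_list_sum_nth atLeast0LessThan)
qed (auto simp: numeral_2_eq_2)

lemma balanced_quad:
  assumes "0 < w" "0 < e"
  shows "balanced 4 2 (pm {w, w + e, w + 2 * e, w + 3 * e})"
proof -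
  have "balanced (length [w, - (w + e), - (w + 2 * e), w + 3 * e]) 2
      (pm (abs ` set [w, - (w + e), - (w + 2 * e), w + 3 * e]))"
    by (rule balanced_pair) (use assms in auto)
  also have "abs ` set [w, - (w + e), - (w + 2 * e), w + 3 * e] = {w, w + e, w + 2 * e, w + 3 * e}"
    using assms by auto
  finally show ?thesis by (simp add: eval_nat_numeral)
qed

lemma balanced_triple:
  assumes "0 < p" "p < q"
  shows "balanced 3 2 (pm {p, q, q + p})"
proof -
  have "balanced (length [p, q, - (q + p)]) 2 (pm (abs ` set [p, q, - (q + p)]))"
    by (rule balanced_pair) (use assms in auto)
  also have "abs ` set [p, q, - (q + p)] = {p, q, q + p}"
    using assms by auto
  finally show ?thesis by (simp add: eval_nat_numeral)
qed

text \<open>With rows counted from 0, the factor \<open>1 - int i\<close> runs through 1, 0, -1.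
  Arrays with row sums of this antipodal shape cancel as soon as their scalar multiples add up to
  zero.\<close>

lemma antipodal_column:
  assumes "0 < c"
  shows "array_on 3 1 (insert 0 (pm {c})) (\<lambda>i. (1 - int i) * c)"
  by (rule array_on_matrix[of "[[c], [0], [-c]]"])
    (use assms in \<open>auto simp: pm_def All_less_Suc eval_nat_numeral\<close>)

text \<open>The bottom row is the negative of the reversed top row and the middle row cancels by
  itself, which forces antipodal row sums. Negating the array gives the second version, so either
  sign is available.\<close>

lemma antipodal_triple:
  assumes "0 < p" "p < q"
  shows "array_on 3 2 (pm {p, q, q + p}) (\<lambda>i. (1 - int i) * (q - p))"
    and "array_on 3 2 (pm {p, q, q + p}) (\<lambda>i. (1 - int i) * (p - q))"
proof -
  show "array_on 3 2 (pm {p, q, q + p}) (\<lambda>i. (1 - int i) * (q - p))"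
    by (rule array_on_matrix[of "[[q, - p], [- (q + p), q + p], [p, - q]]"])
      (use assms in \<open>auto simp: pm_def All_less_Suc eval_nat_numeral\<close>)
  show "array_on 3 2 (pm {p, q, q + p}) (\<lambda>i. (1 - int i) * (p - q))"
    by (rule array_on_matrix[of "[[- q, p], [q + p, - (q + p)], [- p, q]]"])
      (use assms in \<open>auto simp: pm_def All_less_Suc eval_nat_numeral\<close>)
qed

section \<open>Blocks of even size\<close>

definition progression :: "int \<Rightarrow> int \<Rightarrow> nat \<Rightarrow> int set" where
  "progression w e k = (\<lambda>i. w + e * int i) ` {..<k}"

lemma progression_add:
  "progression w e (k + l) = progression w e k \<union> progression (w + e * int k) e l"
proof -
  have "x \<in> (+) k ` {..<l}" if "x < k + l" "\<not> x < k" for x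
    using that by (intro image_eqI[of _ _ "x - k"]) auto
  then have "{..<k + l} = {..<k} \<union> (+) k ` {..<l}"
    by auto
  then show ?thesis
    by (simp add: progression_def image_Un image_image algebra_simps)
qed

lemma progression_disjoint:
  assumes "0 < e"
  shows "progression w e k \<inter> progression (w + e * int k) e l = {}"
proof -
  have "w + e * int i \<noteq> w + e * int k + e * int j" if "i < k" for i j
  proof -
    have "e * int i < e * int k" using assms that by simp
    moreover have "0 \<le> e * int j" using assms by simp
    ultimately show ?thesis by linarith
  qed
  then show ?thesis by (fastforce simp: progression_def)
qed

lemma progression_pos:
  assumes "0 < w" "0 < e"
  shows "progression w e k \<subseteq> {0<..}"
  using assms by (auto simp: progression_def intro: add_pos_nonneg)

lemma progression_one: "progression w 1 k = {w..<w + int k}"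
proof -
  have "x \<in> progression w 1 k" if "w \<le> x" "x < w + int k" for x
    using that by (auto simp: progression_def image_iff intro!: bexI[of _ "nat (x - w)"])
  then show ?thesis by (auto simp: progression_def)
qed

lemma balanced_append_progression:
  assumes "balanced m n (pm (progression w e k))"
    and "balanced m n' (pm (progression (w + e * int k) e l))" and "0 < w" "0 < e"
  shows "balanced m (n + n') (pm (progression w e (k + l)))"
  unfolding progression_add pm_Un using assms
  by (intro balanced_append pm_disjoint progression_disjoint progression_pos)
    (auto intro: add_pos_nonneg)

lemma balanced_four_rows:
  assumes "0 < w" "0 < e"
  shows "balanced 4 (2 * q) (pm (progression w e (4 * q)))"
proof (induction q)
  case 0
  then show ?case by (simp add: progression_def pm_def balanced_empty)
next
  case (Suc q)
  let ?w = "w + e * int (4 * q)"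
  have "progression ?w e 4 = {?w, ?w + e, ?w + 2 * e, ?w + 3 * e}"
    by (simp add: progression_def eval_nat_numeral lessThan_Suc insert_commute algebra_simps)
  moreover have "0 < ?w" using assms by (simp add: add_pos_nonneg)
  ultimately have "balanced 4 2 (pm (progression ?w e 4))"
    using balanced_quad[of ?w e] assms by simp
  from balanced_append_progression[OF Suc this assms] show ?case
    by (simp add: algebra_simps)
qed

text \<open>Strips of four rows are stacked, each taking the next \<open>4 * q\<close> terms. The
  induction runs on the transpose because \<open>balanced_append_progression\<close> adds
  columns.\<close>

lemma balanced_block:
  assumes "0 < w" "0 < e"
  shows "balanced (4 * p) (2 * q) (pm (progression w e (4 * p * q)))"
proof (induction p)
  case 0
  then show ?case by (simp add: progression_def pm_def array_on_def bij_betw_def)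
next
  case (Suc p)
  let ?w = "w + e * int (4 * p * q)"
  have "0 < ?w" using assms by (simp add: add_pos_nonneg)
  then have "balanced (2 * q) 4 (pm (progression ?w e (4 * q)))"
    using assms by (intro balanced_transpose[OF balanced_four_rows])
  from balanced_append_progression[OF balanced_transpose[OF Suc] this assms]
  show ?case by (intro balanced_transpose[of "2 * q"]) (simp add: algebra_simps)
qed

section \<open>Nested pairs with prescribed differences\<close>

text \<open>The pairs \<open>{nest L D d, nest L D d + d}\<close> for \<open>d = 1, \<dots>, D\<close> partition the interval from \<open>L + 1\<close>
  to \<open>L + 2 D + 1\<close> without \<open>nest_hole L D\<close>. Those with \<open>d\<close> even are concentric around the hole, those
  with \<open>d\<close> odd are concentric in the block that follows.\<close>

definition nest_hole :: "int \<Rightarrow> int \<Rightarrow> int" where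
  "nest_hole L D = L + 1 + D div 2"

definition nest :: "int \<Rightarrow> int \<Rightarrow> int \<Rightarrow> int" where
  "nest L D d = (if even d then L + 1 + D div 2 else L + 1 + 2 * (D div 2) + (D + 1) div 2) - d div 2"

text \<open>Replaces the parity test and the division of \<open>d\<close> by one linear parameter,
  so that bounds and collisions of pairs become linear arithmetic.\<close>

lemma nest_cases:
  assumes "1 \<le> d" "d \<le> D"
  obtains (even) e where "d = 2 * e" "1 \<le> e" "e \<le> D div 2" "nest L D d = L + 1 + D div 2 - e"
  | (odd) f where "d = 2 * f + 1" "0 \<le> f" "f < (D + 1) div 2"
    "nest L D d = L + 1 + 2 * (D div 2) + (D + 1) div 2 - f"
proof (cases "even d")
  case True
  then obtain e where "d = 2 * e" by blast
  then show ?thesis using even[of e] assms by (simp add: nest_def)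
next
  case False
  then obtain f where f: "d = 2 * f + 1" by (blast elim: oddE)
  then have "f < (D + 1) div 2" using assms(2) by presburger
  then show ?thesis using odd[of f] f assms by (simp add: nest_def)
qed

lemma nest_bounds:
  assumes "1 \<le> d" "d \<le> D"
  shows "L < nest L D d" "nest L D d + d \<le> L + 2 * D + 1"
proof -
  have eq: "D div 2 + (D + 1) div 2 = D" by presburger
  show "L < nest L D d"
    by (rule nest_cases[OF assms, of L]; use eq in linarith)
  show "nest L D d + d \<le> L + 2 * D + 1"
    by (rule nest_cases[OF assms, of L]; use eq in linarith)
qed

lemma nest_not_hole:
  assumes "1 \<le> d" "d \<le> D"
  shows "nest L D d \<noteq> nest_hole L D" "nest L D d + d \<noteq> nest_hole L D"
  unfolding nest_hole_def by (rule nest_cases[OF assms, of L]; linarith)+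

lemma nest_disjoint:
  assumes "1 \<le> d" "d \<le> D" "1 \<le> d'" "d' \<le> D" "d \<noteq> d'"
  shows "nest L D d \<noteq> nest L D d'" "nest L D d \<noteq> nest L D d' + d'"
    "nest L D d + d \<noteq> nest L D d' + d'"
  by (rule nest_cases[OF assms(1,2), of L]; rule nest_cases[OF assms(3,4), of L];
      use assms(5) in linarith)+

lemma nest_cover:
  assumes "L < x" "x \<le> L + 2 * D + 1" "x \<noteq> nest_hole L D"
  shows "\<exists>d\<in>{1..D}. x = nest L D d \<or> x = nest L D d + d"
proof -
  \<comment> \<open>The pairs with even difference \<open>2 * e\<close> are
    \<open>{c - e, c + e}\<close>, those with odd difference \<open>2 * f + 1\<close> are
    \<open>{h - f, h + f + 1}\<close>. The four cases below are the left and right halves of these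
    two nests, and each witness solves one of the four equations for the difference.\<close>
  define c where "c = L + 1 + D div 2"
  define h where "h = L + 1 + 2 * (D div 2) + (D + 1) div 2"
  have eq: "nest L D d = (if even d then c else h) - d div 2" for d
    by (simp add: nest_def c_def h_def)
  have x: "x \<noteq> c" using assms(3) by (simp add: nest_hole_def c_def)
  consider "x < c" | "c < x" "x \<le> c + D div 2" | "c + D div 2 < x" "x \<le> h" | "h < x"
    using x by linarith
  then show ?thesis
  proof cases
    case 1
    then show ?thesis using assms(1) by (intro bexI[of _ "2 * (c - x)"]) (auto simp: eq c_def)
  next
    case 2
    then show ?thesis by (intro bexI[of _ "2 * (x - c)"]) (auto simp: eq)
  next
    case 3
    then have "2 * (h - x) + 1 \<le> D" unfolding c_def h_def by presburger
    then show ?thesis using 3 by (intro bexI[of _ "2 * (h - x) + 1"]) (auto simp: eq)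
  next
    case 4
    then have "2 * (x - h) - 1 \<le> D" using assms(2) unfolding h_def by presburger
    moreover have "(2 * (x - h) - 1) div 2 = x - h - 1" by presburger
    ultimately show ?thesis using 4 by (intro bexI[of _ "2 * (x - h) - 1"]) (auto simp: eq)
  qed
qed

section \<open>Triples formed by a difference and its pair\<close>

definition nest_triple :: "int \<Rightarrow> int \<Rightarrow> int \<Rightarrow> int set" where
  "nest_triple L D d = {d, nest L D d, nest L D d + d}"

lemma nest_triple_pos:
  assumes "I \<subseteq> {1..D}" "0 \<le> L"
  shows "(\<Union>d\<in>I. nest_triple L D d) \<subseteq> {0<..}"
  using assms nest_bounds[of _ D L] by (force simp: nest_triple_def)

text \<open>All pairs lie above \<open>L\<close>. Differences bounded by \<open>L\<close> therefore
  never meet a pair, and only collisions between two pairs have to be excluded.\<close>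

lemma nest_triple_disjoint:
  assumes "d \<in> {1..D}" "d' \<in> {1..D}" "d \<le> L" "d' \<le> L" "d \<noteq> d'"
  shows "nest_triple L D d \<inter> nest_triple L D d' = {}"
  using assms nest_bounds[of d D L] nest_bounds[of d' D L] nest_disjoint[of d D d' L]
    nest_disjoint[of d' D d L]
  by (auto simp: nest_triple_def)

lemma nest_triple_UN_disjoint:
  assumes "I \<subseteq> {1..D}" "J \<subseteq> {1..D}" "I \<subseteq> {..L}" "J \<subseteq> {..L}" "I \<inter> J = {}"
  shows "(\<Union>d\<in>I. nest_triple L D d) \<inter> (\<Union>d\<in>J. nest_triple L D d) = {}"
proof -
  have "nest_triple L D d \<inter> nest_triple L D d' = {}" if "d \<in> I" "d' \<in> J" for d d'
    using assms that by (intro nest_triple_disjoint) auto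
  then show ?thesis by blast
qed

lemma balanced_nest_triples:
  assumes "I \<subseteq> {1..D}" "I \<subseteq> {..L}"
  shows "balanced 3 (2 * card I) (pm (\<Union>d\<in>I. nest_triple L D d))"
proof -
  have fin: "finite I" using assms(1) finite_subset by blast
  have "balanced 3 2 (pm (nest_triple L D d))" if "d \<in> I" for d
    using balanced_triple[of d "nest L D d"] nest_bounds[of d D L] assms that
    by (force simp: nest_triple_def)
  moreover have "disjoint_family_on (\<lambda>d. pm (nest_triple L D d)) I"
  proof (unfold disjoint_family_on_def, intro ballI impI)
    fix d d' assume *: "d \<in> I" "d' \<in> I" "d \<noteq> d'"
    then have "nest_triple L D d \<inter> nest_triple L D d' = {}"
      using assms by (intro nest_triple_disjoint) auto
    moreover have "nest_triple L D d \<subseteq> {0<..}" "nest_triple L D d' \<subseteq> {0<..}"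
      using nest_triple_pos[of "{d}" D L] nest_triple_pos[of "{d'}" D L] assms * by force+
    ultimately show "pm (nest_triple L D d) \<inter> pm (nest_triple L D d') = {}"
      by (rule pm_disjoint)
  qed
  ultimately show ?thesis
    using balanced_UN[OF fin, of 3 2] by (simp add: pm_UN mult.commute)
qed
text \<open>Shows that the triples and the hole use up an initial interval. \<open>L\<close> and
  \<open>D\<close> are independent because one of the two odd constructions has one more difference
  than small numbers.\<close>

lemma nest_union:
  assumes "0 \<le> L" "0 \<le> D"
  shows "insert (nest_hole L D) ({1..L} \<union> (\<Union>d\<in>{1..D}. {nest L D d, nest L D d + d})) = {1..L + 2 * D + 1}"
    (is "?A = ?B")
proof
  have "nest_hole L D \<in> ?B" using assms unfolding nest_hole_def by auto
  moreover have "{nest L D d, nest L D d + d} \<subseteq> ?B" if "d \<in> {1..D}" for d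
    using nest_bounds[of d D L] that assms by auto
  ultimately show "?A \<subseteq> ?B" using assms by auto
  show "?B \<subseteq> ?A"
  proof
    fix x assume x: "x \<in> ?B"
    consider "x \<le> L" | "x = nest_hole L D" | "L < x" "x \<noteq> nest_hole L D" by linarith
    then show "x \<in> ?A"
    proof cases
      case 3
      then obtain d where "d \<in> {1..D}" "x = nest L D d \<or> x = nest L D d + d"
        using nest_cover[of L x D] x by auto
      then show ?thesis by blast
    qed (use x in auto)
  qed
qed

lemma nest_hole_notin:
  assumes "I \<subseteq> {1..D}" "I \<subseteq> {..L}" "0 \<le> D"
  shows "nest_hole L D \<notin> (\<Union>d\<in>I. nest_triple L D d)"
proof -
  have "nest_hole L D \<notin> nest_triple L D d" if "d \<in> I" for d
  proof -
    have d: "1 \<le> d" "d \<le> D" "d \<le> L" using assms that by auto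
    then have "d < nest_hole L D" using assms(3) unfolding nest_hole_def by presburger
    then show ?thesis using nest_not_hole[of d D L] d by (auto simp: nest_triple_def)
  qed
  then show ?thesis by blast
qed

section \<open>Three-row strips containing zero and the hole\<close>

lemma array_on_append_insert_0:
  assumes "array_on m n (insert 0 (pm A)) \<rho>" "array_on m k (pm B) \<sigma>"
    and "A \<inter> B = {}" "A \<subseteq> {0<..}" "B \<subseteq> {0<..}"
  shows "array_on m (n + k) (insert 0 (pm (A \<union> B))) (\<lambda>i. \<rho> i + \<sigma> i)"
proof -
  have "0 \<notin> pm B" using assms(5) by (auto simp: pm_abs)
  then show ?thesis
    using array_on_append[OF assms(1,2)] pm_disjoint[OF assms(3-5)] by (simp add: pm_Un)
qed

text \<open>The column \<open>(c, 0, -c)\<close> has top entry equal to the hole \<open>c\<close>; the three antipodal triples with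
  differences \<open>1\<close>, \<open>d - 1\<close> and \<open>d\<close> are signed so that their contributions to the top row cancel it.\<close>

lemma balanced_core:
  assumes "odd d" "3 \<le> d" "d \<le> D" "d \<le> L"
  shows "balanced 3 7 (insert 0 (pm (insert (nest_hole L D) (\<Union>k\<in>{1, d - 1, d}. nest_triple L D k))))"
proof -
  let ?c = "nest_hole L D" and ?s = "nest L D" and ?t = "nest_triple L D"
  have sub: "{1, d - 1, d} \<subseteq> {1..D}" "{1, d - 1, d} \<subseteq> {..L}" using assms by auto
  have c0: "0 < ?c" using assms unfolding nest_hole_def by presburger
  have disj: "?t k \<inter> ?t l = {}" if "k \<in> {1, d - 1, d}" "l \<in> {1, d - 1, d}" "k \<noteq> l" for k l
    using that sub by (intro nest_triple_disjoint) auto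
  have pos: "?t k \<subseteq> {0<..}" if "k \<in> {1, d - 1, d}" for k
    using nest_triple_pos[of "{k}" D L] sub that assms by auto
  have hole: "?c \<notin> ?t k" if "k \<in> {1, d - 1, d}" for k
    using nest_hole_notin[of "{k}" D L] sub that assms by auto
  have less: "0 < k" "k < ?s k" if "k \<in> {1, d - 1, d}" for k
    using nest_bounds[of k D L] sub that by auto
  have plus: "array_on 3 2 (pm (?t k)) (\<lambda>i. (1 - int i) * (?s k - k))"
    and minus: "array_on 3 2 (pm (?t k)) (\<lambda>i. (1 - int i) * (k - ?s k))"
    if "k \<in> {1, d - 1, d}" for k
    using antipodal_triple[OF less[OF that]] by (simp_all add: nest_triple_def)
  have A1: "array_on 3 (1 + 2) (insert 0 (pm ({?c} \<union> ?t (d - 1))))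
      (\<lambda>i. (1 - int i) * ?c + (1 - int i) * (d - 1 - ?s (d - 1)))"
    using hole c0 pos by (intro array_on_append_insert_0 antipodal_column minus) auto
  have A2: "array_on 3 (1 + 2 + 2) (insert 0 (pm ({?c} \<union> ?t (d - 1) \<union> ?t d)))
      (\<lambda>i. (1 - int i) * ?c + (1 - int i) * (d - 1 - ?s (d - 1)) + (1 - int i) * (?s d - d))"
    using hole c0 pos disj[of "d - 1" d] by (intro array_on_append_insert_0 A1 plus) auto
  have A3: "array_on 3 (1 + 2 + 2 + 2) (insert 0 (pm ({?c} \<union> ?t (d - 1) \<union> ?t d \<union> ?t 1)))
      (\<lambda>i. (1 - int i) * ?c + (1 - int i) * (d - 1 - ?s (d - 1)) + (1 - int i) * (?s d - d)
        + (1 - int i) * (1 - ?s 1))"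
    using hole c0 pos disj[of "d - 1" 1] disj[of d 1] assms
    by (intro array_on_append_insert_0 A2 minus) auto
  have zero: "?c + (d - 1 - ?s (d - 1)) + (?s d - d) + (1 - ?s 1) = 0"
  proof -
    \<comment> \<open>With \<open>d = 2 * f + 1\<close> and hole \<open>c\<close>, the left ends for
      \<open>d - 1\<close>, \<open>d\<close> and 1 are \<open>c - f\<close>, \<open>h - f\<close>
      and \<open>h\<close>, where \<open>h\<close> depends only on \<open>L\<close> and
      \<open>D\<close>; everything cancels. Oddness of \<open>d\<close> is what places
      \<open>d - 1\<close> in the even nest and \<open>d\<close> in the odd one.\<close>
    obtain f where "d = 2 * f + 1" using assms(1) by (blast elim: oddE)
    then show ?thesis by (simp add: nest_def nest_hole_def)
  qed
  have "(1 - int i) * ?c + (1 - int i) * (d - 1 - ?s (d - 1)) + (1 - int i) * (?s d - d)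
        + (1 - int i) * (1 - ?s 1) = (1 - int i) * (?c + (d - 1 - ?s (d - 1)) + (?s d - d) + (1 - ?s 1))" for i
    by (simp only: distrib_left)
  then have "balanced 3 (1 + 2 + 2 + 2) (insert 0 (pm ({?c} \<union> ?t (d - 1) \<union> ?t d \<union> ?t 1)))"
    using array_on_cong[OF A3, of "\<lambda>_. 0"] zero by simp
  moreover have "{?c} \<union> ?t (d - 1) \<union> ?t d \<union> ?t 1 = insert ?c (\<Union>k\<in>{1, d - 1, d}. ?t k)"
    by auto
  moreover have "1 + 2 + 2 + 2 = (7 :: nat)" by simp
  ultimately show ?thesis by (simp only:)
qed

text \<open>The triples indexed by \<open>X\<close> enter in their balanced form, so each widens the
  core by two columns without disturbing its row sums.\<close>

lemma balanced_three_rows: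
  assumes "odd d" "3 \<le> d" "d \<le> D" "d \<le> L"
    and "X \<subseteq> {1..D}" "X \<subseteq> {..L}" "X \<inter> {1, d - 1, d} = {}"
  shows "balanced 3 (7 + 2 * card X)
    (insert 0 (pm (insert (nest_hole L D) (\<Union>k\<in>{1, d - 1, d} \<union> X. nest_triple L D k))))"
proof -
  let ?c = "nest_hole L D" and ?t = "nest_triple L D"
  have sub: "{1, d - 1, d} \<subseteq> {1..D}" "{1, d - 1, d} \<subseteq> {..L}" using assms by auto
  have c0: "0 < ?c" using assms unfolding nest_hole_def by presburger
  have 1: "insert ?c (\<Union>k\<in>{1, d - 1, d}. ?t k) \<subseteq> {0<..}"
    using nest_triple_pos[OF sub(1), of L] c0 assms(2,4) by auto
  have 2: "(\<Union>k\<in>X. ?t k) \<subseteq> {0<..}"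
    using nest_triple_pos[OF assms(5), of L] assms(2,4) by auto
  have 3: "insert ?c (\<Union>k\<in>{1, d - 1, d}. ?t k) \<inter> (\<Union>k\<in>X. ?t k) = {}"
    using nest_triple_UN_disjoint[OF sub(1) assms(5) sub(2) assms(6)] assms(7)
      nest_hole_notin[OF assms(5,6)] assms(2,3) by (simp add: Int_commute)
  have "balanced 3 (7 + 2 * card X)
    (insert 0 (pm (insert ?c (\<Union>k\<in>{1, d - 1, d}. ?t k) \<union> (\<Union>k\<in>X. ?t k))))"
    using array_on_append_insert_0[OF balanced_core[OF assms(1-4)] balanced_nest_triples[OF assms(5,6)] 3 1 2]
    by simp
  then show ?thesis by (simp add: UN_Un Un_assoc)
qed

text \<open>An even factor makes one side a multiple of four, so \<open>balanced_block\<close>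
  applies directly or after transposing.\<close>

lemma balanced_even_block:
  assumes "even a \<or> even b" "0 < w" "0 < e"
  shows "balanced (2 * a) (2 * b) (pm (progression w e (2 * a * b)))"
proof -
  have *: "balanced (2 * a) (2 * b) (pm (progression w e (2 * a * b)))" if "even a" for a b
  proof -
    obtain p where "a = 2 * p" using \<open>even a\<close> by blast
    then show ?thesis using balanced_block[OF assms(2,3), of p b] by (simp add: mult.assoc)
  qed
  show ?thesis
  proof (cases "even a")
    case False
    then have "even b" using assms by simp
    from balanced_transpose[OF *[OF this, of a]] show ?thesis by (simp add: ac_simps)
  qed (rule *)
qed

lemma insert_0_pm:
  assumes "0 \<le> N"
  shows "insert 0 (pm {1..N}) = {- N..N}"
proof -
  have "x \<in> pm {1..N} \<longleftrightarrow> \<bar>x\<bar> \<in> {1..N}" for x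
    by (rule pm_abs) auto
  then show ?thesis using assms by auto
qed
section \<open>Magic rectangles\<close>

text \<open>Three full rows take the hole column and \<open>b\<close> triples; below them, three
  columns take the other \<open>a - 1\<close> triples. This accounts for
  \<open>M = a + b - 1\<close> triples, built with \<open>L = D = M\<close>. The numbers from
  \<open>3 * M + 2\<close> on fill the remaining \<open>2 * (a - 1)\<close> by
  \<open>2 * (b - 1)\<close> block, for which \<open>a - 1\<close> or \<open>b - 1\<close> must be
  even.\<close>

lemma balanced_odd_not_both_even:
  fixes a b :: nat
  assumes "1 \<le> a" "3 \<le> b" "odd a \<or> odd b"
  shows "balanced (2 * a + 1) (2 * b + 1) {- int (2 * a * b + a + b)..int (2 * a * b + a + b)}"
proof -
  define M where "M = int (a + b) - 1"
  let ?c = "nest_hole M M" and ?t = "nest_triple M M"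
  have M: "3 \<le> M" using assms by (simp add: M_def)
  have "b - 3 \<le> card {4..M}" using assms by (simp add: M_def)
  then obtain X where X: "X \<subseteq> {4..M}" "card X = b - 3" "finite X"
    by (rule obtain_subset_with_card_n)
  define Y where "Y = {4..M} - X"
  have cY: "card Y = a - 1"
    using card_Diff_subset[OF X(3,1)] X(2) assms by (simp add: Y_def M_def)
  have Y: "Y \<subseteq> {1..M}" "Y \<subseteq> {..M}" by (auto simp: Y_def)
  have X': "X \<subseteq> {1..M}" "X \<subseteq> {..M}" using X(1) by auto
  define P1 where "P1 = insert ?c (\<Union>k\<in>{1, 2, 3} \<union> X. ?t k)"
  define P2 where "P2 = (\<Union>k\<in>Y. ?t k)"
  define P3 where "P3 = progression (3 * M + 2) 1 (2 * (a - 1) * (b - 1))"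
  have A1: "balanced 3 (2 * b + 1) (insert 0 (pm P1))"
  proof -
    have "balanced 3 (7 + 2 * card X) (insert 0 (pm P1))"
      using balanced_three_rows[of 3 M M X] X X' M unfolding P1_def by force
    then show ?thesis using X(2) assms(2) by (simp add: algebra_simps)
  qed
  have A2: "balanced (2 * (a - 1)) 3 (pm P2)"
    using balanced_transpose[OF balanced_nest_triples[OF Y]] by (simp add: cY P2_def)
  have A3: "balanced (2 * (a - 1)) (2 * (b - 1)) (pm P3)"
    unfolding P3_def using assms M by (intro balanced_even_block) auto
  have sub: "{1, 2, 3} \<union> X \<subseteq> {1..M}" "{1, 2, 3} \<union> X \<subseteq> {..M}" using X' M by auto
  have cover: "P1 \<union> P2 = {1..3 * M + 1}"
  proof -
    have "{1, 2, 3} \<union> X \<union> Y = {1..M}" using X(1) M by (auto simp: Y_def)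
    then have "P1 \<union> P2 = insert ?c (\<Union>k\<in>{1..M}. ?t k)"
      unfolding P1_def P2_def by (metis UN_Un Un_insert_left)
    also have "\<dots> = insert ?c ({1..M} \<union> (\<Union>d\<in>{1..M}. {nest M M d, nest M M d + d}))"
      unfolding nest_triple_def by blast
    also have "\<dots> = {1..M + 2 * M + 1}"
      using M by (intro nest_union) auto
    finally show ?thesis by simp
  qed
  have P3: "P3 = {3 * M + 2..int (2 * a * b + a + b)}"
  proof -
    obtain a' b' where "a = Suc a'" "b = Suc b'" using that[of "a - 1" "b - 1"] assms by simp
    then show ?thesis by (auto simp: P3_def progression_one M_def algebra_simps)
  qed
  have disj: "P1 \<inter> P2 = {}"
    using nest_triple_UN_disjoint[OF sub(1) Y(1) sub(2) Y(2)] nest_hole_notin[OF Y] M X(1)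
    unfolding P1_def P2_def by (force simp: Y_def)
  have le: "P1 \<subseteq> {1..3 * M + 1}" "P2 \<subseteq> {1..3 * M + 1}"
    using cover by blast+
  have pos: "P1 \<subseteq> {0<..}" "P2 \<subseteq> {0<..}" "P3 \<subseteq> {0<..}"
    using le M by (auto simp: P3)
  have A23: "balanced (2 * (a - 1)) (2 * b + 1) (pm (P2 \<union> P3))"
  proof -
    have "P2 \<inter> P3 = {}" using le by (auto simp: P3)
    then have "balanced (2 * (a - 1)) (3 + 2 * (b - 1)) (pm (P2 \<union> P3))"
      unfolding pm_Un using pos by (intro balanced_append A2 A3 pm_disjoint)
    then show ?thesis using assms by (simp add: algebra_simps)
  qed
  have "balanced (3 + 2 * (a - 1)) (2 * b + 1) (insert 0 (pm P1) \<union> pm (P2 \<union> P3))"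
  proof (rule balanced_stack[OF A1 A23])
    have "P1 \<inter> (P2 \<union> P3) = {}" using disj le by (auto simp: P3)
    then have "pm P1 \<inter> pm (P2 \<union> P3) = {}" using pos by (intro pm_disjoint) auto
    moreover have "0 \<notin> pm (P2 \<union> P3)" using pos pm_abs[of "P2 \<union> P3" 0] by auto
    ultimately show "insert 0 (pm P1) \<inter> pm (P2 \<union> P3) = {}" by auto
  qed
  moreover have "insert 0 (pm P1) \<union> pm (P2 \<union> P3) = {- int (2 * a * b + a + b)..int (2 * a * b + a + b)}"
  proof -
    have "P1 \<union> (P2 \<union> P3) = {1..int (2 * a * b + a + b)}"
    proof -
      have "3 * M + 1 \<le> int (2 * a * b + a + b)"
      proof -
        obtain a' b' where "a = Suc a'" "b = Suc b'" using that[of "a - 1" "b - 1"] assms by simp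
        then show ?thesis by (simp add: M_def algebra_simps)
      qed
      then show ?thesis using cover M unfolding Un_assoc[symmetric] P3 by auto
    qed
    then have "insert 0 (pm P1) \<union> pm (P2 \<union> P3) = insert 0 (pm {1..int (2 * a * b + a + b)})"
      by (metis Un_insert_left pm_Un)
    then show ?thesis by (simp add: insert_0_pm)
  qed
  ultimately show ?thesis using assms(1) by (simp add: algebra_simps)
qed

text \<open>Rests on \<open>p - q + (q + p) + s - (s + 2 * p) = 0\<close>: one small number
  \<open>p\<close> serves two pairs, with differences \<open>p\<close> and
  \<open>2 * p\<close>.\<close>

lemma balanced_quintuple:
  assumes "0 < p" "0 < q" "0 < s" "distinct [p, q, q + p, s, s + 2 * p]"
  shows "balanced 5 2 (pm {p, q, q + p, s, s + 2 * p})"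
proof -
  let ?l = "[p, - q, q + p, s, - (s + 2 * p)]"
  have "balanced (length ?l) 2 (pm (abs ` set ?l))"
    by (rule balanced_pair) (use assms in auto)
  also have "abs ` set ?l = {p, q, q + p, s, s + 2 * p}"
    using assms by auto
  finally show ?thesis by (simp add: eval_nat_numeral)
qed

text \<open>Here \<open>M = a + b - 1 = 2 d - 1\<close> small numbers face the \<open>M + 1\<close> differences \<open>1, \<dots>, 2 d\<close>; the number \<open>d\<close>
  absorbs the two pairs with differences \<open>d\<close> and \<open>2 d\<close>, which gives a \<open>2 \<times> 5\<close> block.\<close>

lemma balanced_odd_both_even:
  fixes a b :: nat
  assumes "2 \<le> a" "4 \<le> b" "even a" "even b"
  shows "balanced (2 * a + 1) (2 * b + 1) {- int (2 * a * b + a + b)..int (2 * a * b + a + b)}"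
proof -
  obtain \<alpha> \<beta> where ab: "a = 2 * \<alpha>" "b = 2 * \<beta>" using assms(3,4) by blast
  define d where "d = int \<alpha> + int \<beta>"
  define M where "M = 2 * d - 1"
  let ?s = "nest M (M + 1)"
  let ?c = "nest_hole M (M + 1)" and ?t = "nest_triple M (M + 1)"
  have d: "3 \<le> d" and M: "5 \<le> M" using assms by (auto simp: d_def M_def ab)
  have card: "card ({2..M - 2} - {d}) = a + b - 5"
    using d by (simp add: M_def d_def ab nat_diff_distrib' nat_add_distrib)
  then have "b - 3 \<le> card ({2..M - 2} - {d})" using assms by simp
  then obtain X where X: "X \<subseteq> {2..M - 2} - {d}" "card X = b - 3" "finite X"
    by (rule obtain_subset_with_card_n)
  define Y where "Y = {2..M - 2} - {d} - X"
  have cY: "card Y = a - 2"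
    using card_Diff_subset[OF X(3,1)] X(2) card assms by (simp add: Y_def)
  have Y: "Y \<subseteq> {1..M + 1}" "Y \<subseteq> {..M}" by (auto simp: Y_def)
  have X': "X \<subseteq> {1..M + 1}" "X \<subseteq> {..M}" using X(1) by auto
  have dd: "{d} \<subseteq> {1..M + 1}" "{d} \<subseteq> {..M}" using d by (auto simp: M_def)
  \<comment> \<open>The rows split as \<open>3 + 2 + 2 * (a - 2)\<close>: \<open>P1\<close> fills
    the first three, \<open>Q\<close> and \<open>P3\<close> the next two, \<open>P2\<close> and
    \<open>P4\<close> the others. The core uses the differences 1, \<open>M - 1\<close>,
    \<open>M\<close> instead of 1, 2, 3, because \<open>d\<close> must stay free for
    \<open>Q\<close> and may equal 3.\<close>
  define P1 where "P1 = insert ?c (\<Union>k\<in>{1, M - 1, M} \<union> X. ?t k)"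
  define P2 where "P2 = (\<Union>k\<in>Y. ?t k)"
  define Q where "Q = ?t d \<union> {?s (M + 1), ?s (M + 1) + (M + 1)}"
  \<comment> \<open>Triples, hole and \<open>Q\<close> end at \<open>3 * M + 3\<close>. Removing
    five rows instead of three makes the remaining blocks admissible: \<open>b - 2\<close> is even
    for \<open>P3\<close> and \<open>a - 2\<close> is even for \<open>P4\<close>.\<close>
  define P3 where "P3 = progression (3 * M + 4) 1 (2 * (b - 2))"
  define P4 where "P4 = progression (3 * M + 4 + int (2 * (b - 2))) 1 (2 * (a - 2) * (b - 1))"
  have A1: "balanced 3 (2 * b + 1) (insert 0 (pm P1))"
  proof -
    have "X \<inter> {1, M - 1, M} = {}" using X(1) by auto
    moreover have "odd M" by (simp add: M_def)
    ultimately have "balanced 3 (7 + 2 * card X) (insert 0 (pm P1))"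
      using X' M unfolding P1_def by (intro balanced_three_rows) auto
    then show ?thesis using X(2) assms(2) by (simp add: algebra_simps)
  qed
  have A2: "balanced (2 * (a - 2)) 3 (pm P2)"
    using balanced_transpose[OF balanced_nest_triples[OF Y]] by (simp add: cY P2_def)
  have A3: "balanced 2 (2 * (b - 2)) (pm P3)"
    unfolding P3_def using balanced_even_block[of 1 "b - 2" "3 * M + 4" 1] assms M by simp
  have A4: "balanced (2 * (a - 2)) (2 * (b - 1)) (pm P4)"
    unfolding P4_def using assms M by (intro balanced_even_block) auto
  have sub: "{1, M - 1, M} \<union> X \<subseteq> {1..M + 1}" "{1, M - 1, M} \<union> X \<subseteq> {..M}" using X' M by auto
  \<comment> \<open>The difference \<open>M + 1\<close> exceeds \<open>L = M\<close>, so it is not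
    one of the small numbers and \<open>nest_triple_disjoint\<close> does not cover it; its pair is
    separated from the other triples by hand.\<close>
  have top: "?s k \<noteq> ?s (M + 1)" "?s k \<noteq> ?s (M + 1) + (M + 1)"
      "?s k + k \<noteq> ?s (M + 1)" "?s k + k \<noteq> ?s (M + 1) + (M + 1)" "M < ?s (M + 1)"
    if "k \<in> {1..M}" for k
    using nest_disjoint[of k "M + 1" "M + 1" M] nest_disjoint[of "M + 1" "M + 1" k M]
      nest_bounds[of "M + 1" "M + 1" M] that by auto
  have A5: "balanced 2 5 (pm Q)"
  proof -
    have "M < ?s d" using nest_bounds[of d "M + 1" M] dd by auto
    then have "distinct [d, ?s d, ?s d + d, ?s (M + 1), ?s (M + 1) + 2 * d]"
      using top[of d] dd d M by (auto simp: M_def)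
    then have "balanced 5 2 (pm {d, ?s d, ?s d + d, ?s (M + 1), ?s (M + 1) + 2 * d})"
      using d \<open>M < ?s d\<close> top[of d] dd M by (intro balanced_quintuple) auto
    also have "{d, ?s d, ?s d + d, ?s (M + 1), ?s (M + 1) + 2 * d} = Q"
      by (auto simp: Q_def nest_triple_def M_def)
    finally show ?thesis by (rule balanced_transpose)
  qed
  have cover: "P1 \<union> P2 \<union> Q = {1..3 * M + 3}"
  proof -
    let ?p = "\<lambda>k. {?s k, ?s k + k}"
    have *: "{1, M - 1, M} \<union> X \<union> Y \<union> {d} = {1..M}" using X(1) M d by (auto simp: Y_def M_def)
    have "P1 \<union> P2 \<union> Q = insert ?c (\<Union>k\<in>{1, M - 1, M} \<union> X \<union> Y \<union> {d}. ?t k) \<union> ?p (M + 1)"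
      unfolding P1_def P2_def Q_def by blast
    also have "\<dots> = insert ?c ({1..M} \<union> (\<Union>k\<in>insert (M + 1) {1..M}. ?p k))"
      unfolding * nest_triple_def by blast
    also have "insert (M + 1) {1..M} = {1..M + 1}" using M by auto
    also have "insert ?c ({1..M} \<union> (\<Union>k\<in>{1..M + 1}. ?p k)) = {1..M + 2 * (M + 1) + 1}"
      using M by (intro nest_union) auto
    finally show ?thesis by simp
  qed
  have P3: "P3 = {3 * M + 4..<3 * M + 4 + int (2 * (b - 2))}"
    by (simp add: P3_def progression_one)
  have P4: "P4 = {3 * M + 4 + int (2 * (b - 2))..int (2 * a * b + a + b)}"
  proof -
    obtain a' b' where "a = a' + 2" "b = b' + 2"
      using that[of "a - 2" "b - 2"] assms by simp
    moreover from this have "M = int a' + int b' + 3" using ab by (simp add: M_def d_def)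
    ultimately show ?thesis by (auto simp: P4_def progression_one algebra_simps)
  qed
  have N: "3 * M + 3 + int (2 * (b - 2)) \<le> int (2 * a * b + a + b)"
  proof -
    obtain a' b' where "a = a' + 2" "b = b' + 2"
      using that[of "a - 2" "b - 2"] assms by simp
    moreover from this have "M = int a' + int b' + 3" using ab by (simp add: M_def d_def)
    ultimately show ?thesis by (simp add: algebra_simps)
  qed
  have le: "P1 \<subseteq> {1..3 * M + 3}" "P2 \<subseteq> {1..3 * M + 3}" "Q \<subseteq> {1..3 * M + 3}"
    using cover by blast+
  have XYd: "({1, M - 1, M} \<union> X) \<inter> (Y \<union> {d}) = {}" "Y \<inter> {d} = {}"
    using X(1) d by (auto simp: Y_def M_def)
  have top_notin: "{?s (M + 1), ?s (M + 1) + (M + 1)} \<inter> (\<Union>k\<in>I. ?t k) = {}" if "I \<subseteq> {1..M}" for I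
  proof -
    have "{?s (M + 1), ?s (M + 1) + (M + 1)} \<inter> ?t k = {}" if "k \<in> I" for k
    proof -
      have "k \<in> {1..M}" using that \<open>I \<subseteq> {1..M}\<close> by blast
      then show ?thesis using top[of k] M by (auto simp: nest_triple_def)
    qed
    then show ?thesis by blast
  qed
  have hole: "?c \<notin> {?s (M + 1), ?s (M + 1) + (M + 1)}"
    using nest_not_hole[of "M + 1" "M + 1" M] M by auto
  define Z where "Z = {1, M - 1, M} \<union> X"
  have Z: "Z \<subseteq> {1..M + 1}" "Z \<subseteq> {..M}" "Z \<inter> Y = {}" "Z \<inter> {d} = {}"
    using sub XYd unfolding Z_def by auto
  have ZM: "Z \<subseteq> {1..M}" and YM: "Y \<subseteq> {1..M}" using Z(1,2) Y by force+
  have P1: "P1 = insert ?c (\<Union>k\<in>Z. ?t k)" by (simp only: P1_def Z_def)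
  have disj12: "P1 \<inter> P2 = {}"
    using nest_triple_UN_disjoint[OF Z(1) Y(1) Z(2) Y(2) Z(3)] nest_hole_notin[OF Y] M
    by (simp add: P1 P2_def)
  have disjoint: "insert c U \<inter> (T \<union> W) = {}"
    if "c \<notin> T" "U \<inter> T = {}" "c \<notin> W" "W \<inter> U = {}" for c :: int and T U W
    using that by blast
  have "?c \<notin> ?t d" using nest_hole_notin[OF dd] M by simp
  moreover have "(\<Union>k\<in>Z. ?t k) \<inter> ?t d = {}"
    using nest_triple_UN_disjoint[OF Z(1) dd(1) Z(2) dd(2) Z(4)] by simp
  ultimately have disj1Q: "P1 \<inter> Q = {}"
    using hole top_notin[OF ZM] unfolding P1 Q_def by (intro disjoint)
  have "(\<Union>k\<in>Y. ?t k) \<inter> ?t d = {}"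
    using nest_triple_UN_disjoint[OF Y(1) dd(1) Y(2) dd(2) XYd(2)] by simp
  then have disj2Q: "P2 \<inter> Q = {}"
    using top_notin[OF YM] unfolding P2_def Q_def by (metis Int_Un_distrib Int_commute Un_empty)
  have pos: "P1 \<subseteq> {0<..}" "P2 \<subseteq> {0<..}" "Q \<subseteq> {0<..}" "P3 \<subseteq> {0<..}" "P4 \<subseteq> {0<..}"
    using le M by (auto simp: P3 P4)
  have far: "P1 \<inter> P3 = {}" "P1 \<inter> P4 = {}" "P2 \<inter> P3 = {}" "P2 \<inter> P4 = {}"
    "Q \<inter> P3 = {}" "Q \<inter> P4 = {}" "P3 \<inter> P4 = {}"
    using le by (auto simp: P3 P4)
  have B1: "balanced 2 (2 * b + 1) (pm (Q \<union> P3))"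
  proof -
    have "balanced 2 (5 + 2 * (b - 2)) (pm (Q \<union> P3))"
      unfolding pm_Un using pos far by (intro balanced_append A5 A3 pm_disjoint)
    then show ?thesis using assms by (simp add: algebra_simps)
  qed
  have B2: "balanced (2 * (a - 2)) (2 * b + 1) (pm (P2 \<union> P4))"
  proof -
    have "balanced (2 * (a - 2)) (3 + 2 * (b - 1)) (pm (P2 \<union> P4))"
      unfolding pm_Un using pos far by (intro balanced_append A2 A4 pm_disjoint)
    then show ?thesis using assms by (simp add: algebra_simps)
  qed
  have "(Q \<union> P3) \<inter> (P2 \<union> P4) = {}" using disj2Q far by blast
  then have "pm (Q \<union> P3) \<inter> pm (P2 \<union> P4) = {}" using pos by (intro pm_disjoint) auto
  from balanced_stack[OF B1 B2 this]
  have B: "balanced (2 + 2 * (a - 2)) (2 * b + 1) (pm (Q \<union> P3 \<union> (P2 \<union> P4)))"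
    by (simp only: pm_Un)
  have "balanced (3 + (2 + 2 * (a - 2))) (2 * b + 1) (insert 0 (pm P1) \<union> pm (Q \<union> P3 \<union> (P2 \<union> P4)))"
  proof (rule balanced_stack[OF A1 B])
    have "P1 \<inter> (Q \<union> P3 \<union> (P2 \<union> P4)) = {}" using disj12 disj1Q far by blast
    then have "pm P1 \<inter> pm (Q \<union> P3 \<union> (P2 \<union> P4)) = {}" using pos by (intro pm_disjoint) auto
    moreover have "0 \<notin> pm (Q \<union> P3 \<union> (P2 \<union> P4))"
      using pos pm_abs[of "Q \<union> P3 \<union> (P2 \<union> P4)" 0] by auto
    ultimately show "insert 0 (pm P1) \<inter> pm (Q \<union> P3 \<union> (P2 \<union> P4)) = {}" by auto
  qed
  moreover have "insert 0 (pm P1) \<union> pm (Q \<union> P3 \<union> (P2 \<union> P4)) =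
      {- int (2 * a * b + a + b)..int (2 * a * b + a + b)}"
  proof -
    have "P1 \<union> (Q \<union> P3 \<union> (P2 \<union> P4)) = (P1 \<union> P2 \<union> Q) \<union> P3 \<union> P4" by blast
    also have "\<dots> = {1..int (2 * a * b + a + b)}"
      using M N unfolding cover P3 P4 by auto
    finally have "insert 0 (pm P1) \<union> pm (Q \<union> P3 \<union> (P2 \<union> P4)) = insert 0 (pm {1..int (2 * a * b + a + b)})"
      by (metis Un_insert_left pm_Un)
    then show ?thesis by (simp add: insert_0_pm)
  qed
  ultimately show ?thesis using assms(1) by (simp add: algebra_simps)
qed
text \<open>The core is seven columns wide, so the general constructions need \<open>b\<close> at
  least 3, or \<open>a\<close> at least 3 after transposing. The sizes 3 by 3, 3 by 5 and 5 by 5 are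
  given explicitly.\<close>

lemma balanced_odd:
  fixes a b :: nat
  assumes "1 \<le> a" "1 \<le> b"
  shows "balanced (2 * a + 1) (2 * b + 1) {- int (2 * a * b + a + b)..int (2 * a * b + a + b)}"
proof -
  have large: "balanced (2 * a + 1) (2 * b + 1) {- int (2 * a * b + a + b)..int (2 * a * b + a + b)}"
    if "1 \<le> a" "3 \<le> b" for a b
  proof (cases "even a \<and> even b")
    case True
    then have "2 \<le> a" "4 \<le> b" using that by (auto elim!: evenE)
    then show ?thesis using True by (intro balanced_odd_both_even) auto
  next
    case False
    then show ?thesis using that by (intro balanced_odd_not_both_even) auto
  qed
  have three_five: "balanced 3 5 {- 7..7}"
    by (rule array_on_matrix[of "[[4, 3, -2, -6, 1], [0, -5, 5, 7, -7], [-4, 2, -3, -1, 6]]"])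
      (simp_all add: All_less_Suc eval_nat_numeral, code_simp)
  consider "3 \<le> b" | "3 \<le> a" | "a = 1" "b = 1" | "a = 1" "b = 2" | "a = 2" "b = 1" | "a = 2" "b = 2"
    using assms by linarith
  then show ?thesis
  proof cases
    case 2
    then show ?thesis using balanced_transpose[OF large[of b a]] assms by (simp add: ac_simps)
  next
    case 3
    have "balanced 3 3 {- 4..4}"
      by (rule array_on_matrix[of "[[3, -4, 1], [-2, 0, 2], [-1, 4, -3]]"])
        (simp_all add: All_less_Suc eval_nat_numeral, code_simp)
    then show ?thesis by (simp add: 3 eval_nat_numeral)
  next
    case 4
    then show ?thesis using three_five by (simp add: eval_nat_numeral)
  next
    case 5
    then show ?thesis using balanced_transpose[OF three_five] by (simp add: eval_nat_numeral)
  next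
    case 6
    have "balanced 5 5 {- 12..12}"
      by (rule array_on_matrix[of "[[4, 11, -12, -5, 2], [10, -8, -6, 1, 3], [-9, -7, 0, 7, 9],
            [-3, -1, 6, 8, -10], [-2, 5, 12, -11, -4]]"])
        (simp_all add: All_less_Suc eval_nat_numeral, code_simp)
    then show ?thesis by (simp add: 6 eval_nat_numeral)
  qed (use large assms in auto)
qed

text \<open>If \<open>a\<close> and \<open>b\<close> are both odd, neither side is a multiple of
  four. Two rows are then split off, with a 2 by 6 block at their start; what remains of these rows
  and the \<open>2 * (a - 1)\<close> rows below are blocks with a side divisible by four.\<close>

lemma balanced_even:
  fixes a b :: nat
  assumes "2 \<le> a" "2 \<le> b"
  shows "balanced (2 * a) (2 * b) (pm (progression 1 2 (2 * a * b)))"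
proof (cases "even a \<or> even b")
  case True
  then show ?thesis by (intro balanced_even_block) auto
next
  case False
  then have ab: "3 \<le> a" "3 \<le> b" using assms by (auto elim!: oddE)
  \<comment> \<open>The signs realise \<open>1 + 3 + 5 - 7 + 9 - 11 = 0\<close>.\<close>
  have six: "balanced 6 2 (pm (progression 1 2 6))"
  proof -
    let ?l = "[1, 3, 5, - 7, 9, - 11] :: int list"
    have "balanced (length ?l) 2 (pm (abs ` set ?l))"
      by (rule balanced_pair) auto
    also have "abs ` set ?l = progression 1 2 6"
      by (auto simp: progression_def eval_nat_numeral lessThan_Suc)
    finally show ?thesis by (simp add: eval_nat_numeral)
  qed
  have "balanced (2 * 1) (2 * (b - 3)) (pm (progression (1 + 2 * int 6) 2 (2 * 1 * (b - 3))))"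
    using False ab by (intro balanced_even_block) auto
  with balanced_transpose[OF six]
  have "balanced 2 (6 + 2 * (b - 3)) (pm (progression 1 2 (6 + 2 * (b - 3))))"
    by (intro balanced_append_progression) auto
  then have 1: "balanced 2 (2 * b) (pm (progression 1 2 (2 * b)))"
    using ab by (simp add: algebra_simps)
  have 2: "balanced (2 * (a - 1)) (2 * b) (pm (progression (1 + 2 * int (2 * b)) 2 (2 * (a - 1) * b)))"
    using False ab by (intro balanced_even_block) auto
  from 1 2 have "balanced (2 * b) (2 + 2 * (a - 1)) (pm (progression 1 2 (2 * b + 2 * (a - 1) * b)))"
    by (intro balanced_append_progression balanced_transpose[of _ "2 * b"]) auto
  moreover have "2 * b + 2 * (a - 1) * b = 2 * a * b" "2 + 2 * (a - 1) = 2 * a"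
    using ab by (cases a; simp add: algebra_simps)+
  ultimately show ?thesis by (intro balanced_transpose[of "2 * b"]) simp
qed

text \<open>An entry \<open>r\<close> is centred as \<open>2 * r - m * n - 1\<close>, an integer for
  either parity of \<open>m * n\<close>. The centred entries are the odd integers in the range if
  \<open>m * n\<close> is even and the even ones if it is odd.\<close>

lemma magic_rectangle_of_balanced:
  fixes m n :: nat
  assumes "balanced m n {x. \<bar>x\<bar> < int (m * n) \<and> odd (x + int (m * n))}"
  shows "\<exists>R :: nat \<Rightarrow> nat \<Rightarrow> nat. bij_betw (\<lambda>(i, j). R i j) ({..<m} \<times> {..<n}) {1..m * n} \<and>
    (\<forall>i<m. 2 * (\<Sum>j<n. R i j) = n * (m * n + 1)) \<and> (\<forall>j<n. 2 * (\<Sum>i<m. R i j) = m * (m * n + 1))"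
proof -
  define K where "K = m * n"
  define S where "S = {x. \<bar>x\<bar> < int K \<and> odd (x + int K)}"
  obtain v where v: "bij_betw (\<lambda>(i, j). v i j) ({..<m} \<times> {..<n}) S"
    "\<forall>i<m. (\<Sum>j<n. v i j) = 0" "\<forall>j<n. (\<Sum>i<m. v i j) = 0"
    using assms unfolding array_on_def S_def K_def by blast
  let ?g = "\<lambda>x. nat ((x + int K + 1) div 2)"
  have g: "2 * int (?g x) = x + int K + 1" if "x \<in> S" for x
  proof -
    have "even (x + int K + 1)" "0 \<le> x + int K + 1" using that by (auto simp: S_def)
    then show ?thesis by (simp only: even_two_times_div_two nat_0_le pos_imp_zdiv_nonneg_iff zero_less_numeral)
  qed
  have "bij_betw ?g S {1..K}"
  proof (rule bij_betw_byWitness[where f' = "\<lambda>r. 2 * int r - int K - 1"])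
    show "\<forall>x\<in>S. 2 * int (?g x) - int K - 1 = x" using g by simp
    show "\<forall>r\<in>{1..K}. ?g (2 * int r - int K - 1) = r" by simp
    show "?g ` S \<subseteq> {1..K}" by (auto simp: S_def)
    show "(\<lambda>r. 2 * int r - int K - 1) ` {1..K} \<subseteq> S" by (auto simp: S_def)
  qed
  from bij_betw_trans[OF v(1) this]
  have bij: "bij_betw (\<lambda>(i, j). ?g (v i j)) ({..<m} \<times> {..<n}) {1..K}"
    by (rule bij_betw_cong[THEN iffD1, rotated]) auto
  have gv: "2 * int (?g (v i j)) = v i j + int K + 1" if "i < m" "j < n" for i j
    using bij_betwE[OF v(1)] that by (intro g) auto
  have "2 * (\<Sum>j<n. ?g (v i j)) = n * (K + 1)" if "i < m" for i
  proof -
    have "int (2 * (\<Sum>j<n. ?g (v i j))) = (\<Sum>j<n. 2 * int (?g (v i j)))"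
      by (simp add: sum_distrib_left)
    also have "\<dots> = (\<Sum>j<n. v i j + (int K + 1))" using gv that by (intro sum.cong) auto
    also have "\<dots> = int (n * (K + 1))" using v(2) that by (simp add: sum.distrib algebra_simps)
    finally show ?thesis by linarith
  qed
  moreover have "2 * (\<Sum>i<m. ?g (v i j)) = m * (K + 1)" if "j < n" for j
  proof -
    have "int (2 * (\<Sum>i<m. ?g (v i j))) = (\<Sum>i<m. 2 * int (?g (v i j)))"
      by (simp add: sum_distrib_left)
    also have "\<dots> = (\<Sum>i<m. v i j + (int K + 1))" using gv that by (intro sum.cong) auto
    also have "\<dots> = int (m * (K + 1))" using v(3) that by (simp add: sum.distrib algebra_simps)
    finally show ?thesis by linarith
  qed
  ultimately show ?thesis
    using bij unfolding K_def by (intro exI[of _ "\<lambda>i j. ?g (v i j)"]) (simp add: K_def)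
qed

theorem magic_rectangle:
  fixes m n :: nat
  assumes "3 \<le> m" "3 \<le> n" "even m \<longleftrightarrow> even n"
  shows "\<exists>R :: nat \<Rightarrow> nat \<Rightarrow> nat. bij_betw (\<lambda>(i, j). R i j) ({..<m} \<times> {..<n}) {1..m * n} \<and>
    (\<forall>i<m. 2 * (\<Sum>j<n. R i j) = n * (m * n + 1)) \<and> (\<forall>j<n. 2 * (\<Sum>i<m. R i j) = m * (m * n + 1))"
proof (rule magic_rectangle_of_balanced, cases "even m")
  case True
  then obtain a b where ab: "m = 2 * a" "n = 2 * b" using assms(3) by (metis evenE)
  have "pm (progression 1 2 (2 * a * b)) = {x. \<bar>x\<bar> < int (m * n) \<and> odd (x + int (m * n))}"
  proof -
    have "y \<in> progression 1 2 (2 * a * b) \<longleftrightarrow> 0 \<le> y \<and> y < int (m * n) \<and> odd y" for y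
    proof
      assume "y \<in> progression 1 2 (2 * a * b)"
      then obtain i where i: "i < 2 * a * b" "y = 1 + 2 * int i" by (auto simp: progression_def)
      moreover have "int (m * n) = 2 * int (2 * a * b)" by (simp add: ab)
      moreover have "int i < int (2 * a * b)" using i(1) by (simp only: of_nat_less_iff)
      ultimately show "0 \<le> y \<and> y < int (m * n) \<and> odd y" by (simp del: of_nat_mult)
    next
      assume y: "0 \<le> y \<and> y < int (m * n) \<and> odd y"
      then obtain k where k: "y = 2 * k + 1" by (auto elim: oddE)
      moreover from this have "0 \<le> k" "k < int (2 * a * b)" using y by (auto simp: ab)
      ultimately show "y \<in> progression 1 2 (2 * a * b)"
        unfolding progression_def by (intro image_eqI[of _ _ "nat k"]) (simp_all add: nat_less_iff)
    qed
    moreover have "progression 1 2 (2 * a * b) \<subseteq> {0<..}" by (intro progression_pos) auto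
    ultimately show ?thesis by (auto simp: pm_abs ab)
  qed
  moreover have "balanced m n (pm (progression 1 2 (2 * a * b)))"
    unfolding ab using assms by (intro balanced_even) (auto simp: ab)
  ultimately show "balanced m n {x. \<bar>x\<bar> < int (m * n) \<and> odd (x + int (m * n))}" by simp
next
  case False
  then obtain a b where ab: "m = 2 * a + 1" "n = 2 * b + 1" using assms(3) by (metis oddE)
  let ?N = "int (2 * a * b + a + b)"
  have "balanced m n ((*) 2 ` {- ?N..?N})"
    unfolding ab using assms by (intro balanced_scale balanced_odd) (auto simp: ab)
  moreover have "(*) 2 ` {- ?N..?N} = {x. \<bar>x\<bar> < int (m * n) \<and> odd (x + int (m * n))}"
  proof -
    have K: "int (m * n) = 2 * ?N + 1" by (simp add: ab algebra_simps)
    have "x \<in> (*) 2 ` {- ?N..?N}" if "\<bar>x\<bar> < 2 * ?N + 1" "odd (x + (2 * ?N + 1))" for x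
    proof -
      obtain k where "x = 2 * k" using \<open>odd (x + (2 * ?N + 1))\<close> by (auto elim: evenE)
      then show ?thesis using that(1) by (intro image_eqI[of _ _ k]) auto
    qed
    then show ?thesis unfolding K by auto
  qed
  ultimately show "balanced m n {x. \<bar>x\<bar> < int (m * n) \<and> odd (x + int (m * n))}" by simp
qed
section \<open>Labelings of joins\<close>

lemma finite_edges: "simple_graph G \<Longrightarrow> finite (edges G)"
  using finite_subset[of "edges G" "Pow (verts G)"] by (auto simp: simple_graph_def)

text \<open>Double counting of incidences. It rewrites the number of edges of the first graph, by
  which the labels of the second are shifted, and so produces the term with \<open>r\<^sub>1\<close>
  times \<open>r\<^sub>2\<close> in the excluded value.\<close>

lemma handshake:
  assumes "simple_graph G" "regular_graph G r"
  shows "2 * card (edges G) = card (verts G) * r"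
proof -
  have "card {v \<in> verts G. v \<in> e} = 2" if "e \<in> edges G" for e
  proof -
    have "{v \<in> verts G. v \<in> e} = e" using assms(1) that by (auto simp: simple_graph_def)
    then show ?thesis using assms(1) that by (simp add: simple_graph_def)
  qed
  then have "(\<Sum>v\<in>verts G. card {e \<in> edges G. v \<in> e}) = 2 * card (edges G)"
    using assms(1) finite_edges[OF assms(1)]
    by (intro sum_multicount) (auto simp: simple_graph_def)
  then show ?thesis using assms(2) by (simp add: regular_graph_def degree_def)
qed

text \<open>Vertex sums are colours with arbitrary values, whereas the chromatic number asks for an
  initial segment; a bijection renumbers the colours that occur.\<close>

lemma chromatic_number_le:
  assumes "simple_graph G" "\<And>u v. {u, v} \<in> edges G \<Longrightarrow> c u \<noteq> c v"
  shows "\<chi> G \<le> card (c ` verts G)"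
proof -
  have "finite (c ` verts G)" using assms(1) by (simp add: simple_graph_def)
  then obtain h where h: "bij_betw h (c ` verts G) {0..<card (c ` verts G)}"
    using ex_bij_betw_finite_nat by blast
  have "proper_coloring G (h \<circ> c)"
    unfolding proper_coloring_def
  proof (intro allI impI)
    fix u v assume uv: "{u, v} \<in> edges G"
    then have "u \<in> verts G" "v \<in> verts G" using assms(1) by (auto simp: simple_graph_def)
    then show "(h \<circ> c) u \<noteq> (h \<circ> c) v"
      using bij_betw_imp_inj_on[OF h] assms(2)[OF uv] by (auto simp: inj_on_def)
  qed
  moreover have "(h \<circ> c) ` verts G \<subseteq> {..<card (c ` verts G)}"
    using bij_betw_imp_surj_on[OF h] by (auto simp: image_comp[symmetric])
  ultimately show ?thesis
    unfolding chromatic_number_def by (intro Least_le) blast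
qed

lemma chromatic_number_join_le_num_colors:
  assumes "simple_graph G" "simple_graph H" "local_antimagic_labeling (G \<or>\<^sub>G H) f"
  shows "\<chi> G + \<chi> H \<le> num_colors (G \<or>\<^sub>G H) f"
proof -
  let ?s = "vertex_sum (G \<or>\<^sub>G H) f"
  have ne: "?s u \<noteq> ?s v" if "{u, v} \<in> edges (G \<or>\<^sub>G H)" for u v
    using assms(3) that by (simp add: local_antimagic_labeling_def)
  have fin: "finite (verts G)" "finite (verts H)" using assms(1,2) by (auto simp: simple_graph_def)
  have "\<chi> G \<le> card (?s ` verts G)" "\<chi> H \<le> card (?s ` verts H)"
    using assms(1,2) by (intro chromatic_number_le ne; simp add: join_def)+
  moreover have "?s u \<noteq> ?s v" if "u \<in> verts G" "v \<in> verts H" for u v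
    using that by (intro ne) (auto simp: join_def)
  then have "?s ` verts G \<inter> ?s ` verts H = {}" by blast
  then have "card (?s ` verts (G \<or>\<^sub>G H)) = card (?s ` verts G) + card (?s ` verts H)"
    using fin by (simp add: join_def image_Un card_Un_disjoint)
  ultimately show ?thesis by (simp add: num_colors_def)
qed

section \<open>Vertex sums and labels in a join\<close>

lemma vertex_sum_join:
  assumes "simple_graph G" "simple_graph H" "verts G \<inter> verts H = {}" "u \<in> verts G"
  shows "vertex_sum (G \<or>\<^sub>G H) g u = vertex_sum G g u + (\<Sum>v\<in>verts H. g {u, v})"
proof -
  have "{e. e \<in> edges (G \<or>\<^sub>G H) \<and> u \<in> e} = {e. e \<in> edges G \<and> u \<in> e} \<union> (\<lambda>v. {u, v}) ` verts H"
    using assms(2-4) by (auto simp: join_def simple_graph_def)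
  moreover have "{e. e \<in> edges G \<and> u \<in> e} \<inter> (\<lambda>v. {u, v}) ` verts H = {}"
    using assms(1,3) by (fastforce simp: simple_graph_def)
  moreover have "inj_on (\<lambda>v. {u, v}) (verts H)"
    by (auto simp: inj_on_def doubleton_eq_iff)
  moreover have "finite (edges G)" "finite (verts H)"
    using finite_edges[OF assms(1)] assms(2) by (auto simp: simple_graph_def)
  ultimately show ?thesis
    by (simp add: vertex_sum_def sum.union_disjoint sum.reindex)
qed

lemma vertex_sum_shift:
  assumes "\<And>e. e \<in> edges G \<Longrightarrow> g e = k + f e"
  shows "vertex_sum G g u = degree G u * k + vertex_sum G f u"
  using assms by (simp add: vertex_sum_def degree_def sum.distrib)

lemma bij_betw_shift:
  fixes f :: "'b \<Rightarrow> nat"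
  assumes "bij_betw f A {1..n}"
  shows "bij_betw (\<lambda>x. k + f x) A {k + 1..k + n}"
proof -
  have "bij_betw ((+) k) {1..n} {k + 1..k + n}" by (simp add: bij_betw_def)
  from bij_betw_trans[OF assms this] show ?thesis by (simp add: comp_def)
qed

text \<open>The join edges receive the smallest labels, from a magic rectangle, so that they add the same
  amount to all vertices of \<open>G\<close> and the same amount to all vertices of \<open>H\<close>.\<close>

lemma join_labeling:
  fixes G H :: "'a graph"
  assumes G: "simple_graph G" "regular_graph G r" and H: "simple_graph H" "regular_graph H s"
    and disj: "verts G \<inter> verts H = {}"
    and f: "bij_betw f (edges G) {1..card (edges G)}" and h: "bij_betw h (edges H) {1..card (edges H)}"
    and big: "3 \<le> card (verts G)" "3 \<le> card (verts H)"
      "even (card (verts G)) \<longleftrightarrow> even (card (verts H))"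
  defines "K \<equiv> card (verts G) * card (verts H)"
  shows "\<exists>g. bij_betw g (edges (G \<or>\<^sub>G H)) {1..card (edges (G \<or>\<^sub>G H))} \<and>
    (\<forall>u\<in>verts G. 2 * vertex_sum (G \<or>\<^sub>G H) g u =
       2 * vertex_sum G f u + 2 * r * K + card (verts H) * (K + 1)) \<and>
    (\<forall>v\<in>verts H. 2 * vertex_sum (G \<or>\<^sub>G H) g v =
       2 * vertex_sum H h v + 2 * s * (K + card (edges G)) + card (verts G) * (K + 1))"
proof -
  define m n where "m = card (verts G)" and "n = card (verts H)"
  have K: "K = m * n" by (simp add: K_def m_def n_def)
  have fin: "finite (verts G)" "finite (verts H)" using G H by (auto simp: simple_graph_def)
  obtain R where R: "bij_betw (\<lambda>(i, j). R i j) ({..<m} \<times> {..<n}) {1..K}"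
    "\<forall>i<m. 2 * (\<Sum>j<n. R i j) = n * (K + 1)" "\<forall>j<n. 2 * (\<Sum>i<m. R i j) = m * (K + 1)"
    using magic_rectangle[OF big] unfolding K_def m_def n_def by blast
  obtain \<phi> where \<phi>: "bij_betw \<phi> (verts G) {..<m}"
    using ex_bij_betw_finite_nat[OF fin(1)] by (auto simp: m_def atLeast0LessThan)
  obtain \<psi> where \<psi>: "bij_betw \<psi> (verts H) {..<n}"
    using ex_bij_betw_finite_nat[OF fin(2)] by (auto simp: n_def atLeast0LessThan)
  \<comment> \<open>A join edge meets each side in exactly one vertex, so \<open>the_elem\<close>
    recovers the row and the column of its entry in the rectangle.\<close>
  define g where "g e = (if e \<in> edges G then K + f e else if e \<in> edges H then K + card (edges G) + h e
    else R (\<phi> (the_elem (e \<inter> verts G))) (\<psi> (the_elem (e \<inter> verts H))))" for e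
  define C where "C = (\<lambda>(u, v). {u, v}) ` (verts G \<times> verts H)"
  have edges: "edges (G \<or>\<^sub>G H) = C \<union> edges G \<union> edges H"
    unfolding join_def C_def by auto
  have notin: "{u, v} \<notin> edges G" "{u, v} \<notin> edges H" if "u \<in> verts G" "v \<in> verts H" for u v
    using G(1) H(1) disj that unfolding simple_graph_def by blast+
  have gC: "g {u, v} = R (\<phi> u) (\<psi> v)" if "u \<in> verts G" "v \<in> verts H" for u v
  proof -
    have "{u, v} \<inter> verts G = {u}" "{u, v} \<inter> verts H = {v}" using that disj by auto
    then show ?thesis using notin[OF that] by (simp add: g_def)
  qed
  have edge_ne: "e \<noteq> {}" if "e \<in> edges G" for e
    using G(1) that by (auto simp: simple_graph_def)
  \<comment> \<open>A common edge would lie in both vertex sets and hence be empty, which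
    \<open>edge_ne\<close> excludes.\<close>
  have EGH: "e \<notin> edges G" if "e \<in> edges H" for e
    using G(1) H(1) disj that edge_ne[of e] unfolding simple_graph_def by blast
  have gG: "g e = K + f e" if "e \<in> edges G" for e
    using that by (simp add: g_def)
  have gH: "g e = K + card (edges G) + h e" if "e \<in> edges H" for e
    using that EGH by (simp add: g_def)
  \<comment> \<open>Bijectivity is checked on pairs of vertices and carried over to the join edges
    along the bijection sending \<open>(u, v)\<close> to \<open>{u, v}\<close>.\<close>
  have "bij_betw g C {1..K}"
  proof -
    have "inj_on (\<lambda>(u, v). {u, v}) (verts G \<times> verts H)"
      using disj by (auto simp: inj_on_def doubleton_eq_iff)
    then have "bij_betw (\<lambda>(u, v). {u, v}) (verts G \<times> verts H) C"
      by (simp add: bij_betw_def C_def)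
    moreover have "bij_betw (\<lambda>(u, v). R (\<phi> u) (\<psi> v)) (verts G \<times> verts H) {1..K}"
      using bij_betw_trans[OF bij_betw_map_prod[OF \<phi> \<psi>] R(1)]
      by (rule bij_betw_cong[THEN iffD1, rotated]) auto
    then have "bij_betw (g \<circ> (\<lambda>(u, v). {u, v})) (verts G \<times> verts H) {1..K}"
      by (rule bij_betw_cong[THEN iffD1, rotated]) (auto simp: gC)
    ultimately show ?thesis using bij_betw_comp_iff by blast
  qed
  moreover have "bij_betw g (edges G) {K + 1..K + card (edges G)}"
    using bij_betw_shift[OF f] by (rule bij_betw_cong[THEN iffD1, rotated]) (simp add: gG)
  moreover have "bij_betw g (edges H) {K + card (edges G) + 1..K + card (edges G) + card (edges H)}"
    using bij_betw_shift[OF h] by (rule bij_betw_cong[THEN iffD1, rotated]) (simp add: gH)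
  ultimately have "bij_betw g (C \<union> edges G \<union> edges H)
      ({1..K} \<union> {K + 1..K + card (edges G)} \<union> {K + card (edges G) + 1..K + card (edges G) + card (edges H)})"
    by (intro bij_betw_combine) auto
  moreover have "{1..K} \<union> {K + 1..K + card (edges G)}
      \<union> {K + card (edges G) + 1..K + card (edges G) + card (edges H)} = {1..K + card (edges G) + card (edges H)}"
    by auto
  ultimately have bij: "bij_betw g (edges (G \<or>\<^sub>G H)) {1..K + card (edges G) + card (edges H)}"
    by (simp add: edges)
  have "2 * vertex_sum (G \<or>\<^sub>G H) g u = 2 * vertex_sum G f u + 2 * r * K + n * (K + 1)"
    if u: "u \<in> verts G" for u
  proof -
    have "(\<Sum>v\<in>verts H. g {u, v}) = (\<Sum>v\<in>verts H. R (\<phi> u) (\<psi> v))"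
      using u gC by simp
    also have "\<dots> = (\<Sum>j<n. R (\<phi> u) j)" by (rule sum.reindex_bij_betw[OF \<psi>])
    finally have "2 * (\<Sum>v\<in>verts H. g {u, v}) = n * (K + 1)"
      using R(2) bij_betwE[OF \<phi>] u by simp
    moreover have "vertex_sum G g u = r * K + vertex_sum G f u"
      using vertex_sum_shift[of G g K f u] gG G(2) u by (simp add: regular_graph_def)
    ultimately show ?thesis using vertex_sum_join[OF G(1) H(1) disj u, of g] by simp
  qed
  moreover have "2 * vertex_sum (G \<or>\<^sub>G H) g v
      = 2 * vertex_sum H h v + 2 * s * (K + card (edges G)) + m * (K + 1)"
    if v: "v \<in> verts H" for v
  proof -
    have "(\<Sum>u\<in>verts G. g {v, u}) = (\<Sum>u\<in>verts G. R (\<phi> u) (\<psi> v))"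
      using v gC by (simp add: insert_commute)
    also have "\<dots> = (\<Sum>i<m. R i (\<psi> v))" by (rule sum.reindex_bij_betw[OF \<phi>])
    finally have "2 * (\<Sum>u\<in>verts G. g {v, u}) = m * (K + 1)"
      using R(3) bij_betwE[OF \<psi>] v by simp
    moreover have "vertex_sum H g v = s * (K + card (edges G)) + vertex_sum H h v"
      using vertex_sum_shift[of H g "K + card (edges G)" h v] gH H(2) v by (simp add: regular_graph_def)
    ultimately show ?thesis
      using vertex_sum_join[OF H(1) G(1) _ v, of g] disj by (simp add: join_commute[of G] Int_commute)
  qed
  moreover have "card (edges (G \<or>\<^sub>G H)) = K + card (edges G) + card (edges H)"
    using bij_betw_same_card[OF bij] by simp
  ultimately show ?thesis using bij unfolding m_def n_def by (intro exI[of _ g]) simp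
qed

text \<open>Each value of \<open>g\<close> is determined by the value of \<open>f\<close>, so a
  uniform shift cannot create colours. The doubled form matches the magic sums, which are stated
  without halves.\<close>

lemma card_image_le_of_shift:
  assumes "finite A" "\<And>x. x \<in> A \<Longrightarrow> 2 * g x = 2 * f x + (k :: nat)"
  shows "card (g ` A) \<le> card (f ` A)"
proof -
  have "g x = (2 * f x + k) div 2" if "x \<in> A" for x
    using assms(2)[OF that] by simp
  then have "g ` A = (\<lambda>y. (2 * y + k) div 2) ` f ` A"
    by (simp add: image_image)
  then show ?thesis using card_image_le[of "f ` A"] assms(1) by simp
qed

theorem theorem3p15:
  fixes G\<^sub>1 G\<^sub>2 :: "'a graph"
    and r\<^sub>1 r\<^sub>2 t\<^sub>1 t\<^sub>2 p\<^sub>1 p\<^sub>2 r :: nat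
    and f\<^sub>1 f\<^sub>2 :: "'a set \<Rightarrow> nat"
  assumes "r\<^sub>1 \<ge> 2" and "r\<^sub>2 \<ge> 2" and "t\<^sub>1 \<ge> 3" and "t\<^sub>2 \<ge> 3"
    and "simple_graph G\<^sub>1" and "regular_graph G\<^sub>1 r\<^sub>1" and "card (verts G\<^sub>1) = p\<^sub>1"
    and "simple_graph G\<^sub>2" and "regular_graph G\<^sub>2 r\<^sub>2" and "card (verts G\<^sub>2) = p\<^sub>2"
    and "local_antimagic_coloring G\<^sub>1 t\<^sub>1 f\<^sub>1"
    and "local_antimagic_coloring G\<^sub>2 t\<^sub>2 f\<^sub>2"
    and "verts G\<^sub>1 \<inter> verts G\<^sub>2 = {}"
    and "r\<^sub>1 + p\<^sub>2 = r" and "r\<^sub>2 + p\<^sub>1 = r"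
    and "[p\<^sub>1 = p\<^sub>2] (mod 2)"
    and "\<forall>u\<in>verts G\<^sub>1. \<forall>v\<in>verts G\<^sub>2.
           real (vertex_sum G\<^sub>2 f\<^sub>2 v) - real (vertex_sum G\<^sub>1 f\<^sub>1 u) \<noteq>
             (real p\<^sub>2 - real p\<^sub>1) * (real p\<^sub>1 * real p\<^sub>2 + 1) / 2
             + (real r\<^sub>1 - real r\<^sub>2) * real p\<^sub>1 * real p\<^sub>2
             - real p\<^sub>1 * real r\<^sub>1 * real r\<^sub>2 / 2"
  shows "\<chi>\<^sub>l\<^sub>a (G\<^sub>1 \<or>\<^sub>G G\<^sub>2) \<le> enat (t\<^sub>1 + t\<^sub>2) \<and>
         (\<chi> G\<^sub>1 = t\<^sub>1 \<and> \<chi> G\<^sub>2 = t\<^sub>2 \<longrightarrow> \<chi>\<^sub>l\<^sub>a (G\<^sub>1 \<or>\<^sub>G G\<^sub>2) = enat (t\<^sub>1 + t\<^sub>2))"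
proof -
  note G\<^sub>1 = assms(5-7) and G\<^sub>2 = assms(8-10)
  let ?G = "G\<^sub>1 \<or>\<^sub>G G\<^sub>2"
  let ?s = "vertex_sum ?G" and ?q = "card (edges G\<^sub>1)"
  define K where "K = p\<^sub>1 * p\<^sub>2"
  have fin: "finite (verts G\<^sub>1)" "finite (verts G\<^sub>2)" using G\<^sub>1 G\<^sub>2 by (auto simp: simple_graph_def)
  have f\<^sub>1: "bij_betw f\<^sub>1 (edges G\<^sub>1) {1..?q}" "card (vertex_sum G\<^sub>1 f\<^sub>1 ` verts G\<^sub>1) = t\<^sub>1"
      "\<And>u v. {u, v} \<in> edges G\<^sub>1 \<Longrightarrow> vertex_sum G\<^sub>1 f\<^sub>1 u \<noteq> vertex_sum G\<^sub>1 f\<^sub>1 v"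
    and f\<^sub>2: "bij_betw f\<^sub>2 (edges G\<^sub>2) {1..card (edges G\<^sub>2)}" "card (vertex_sum G\<^sub>2 f\<^sub>2 ` verts G\<^sub>2) = t\<^sub>2"
      "\<And>u v. {u, v} \<in> edges G\<^sub>2 \<Longrightarrow> vertex_sum G\<^sub>2 f\<^sub>2 u \<noteq> vertex_sum G\<^sub>2 f\<^sub>2 v"
    using assms(11,12)
    by (auto simp: local_antimagic_coloring_def local_antimagic_labeling_def num_colors_def)
  \<comment> \<open>A graph has at least as many vertices as colours, so three colours already give
    the side lengths that \<open>magic_rectangle\<close> demands.\<close>
  have "3 \<le> p\<^sub>1" "3 \<le> p\<^sub>2"
    using card_image_le[OF fin(1), of "vertex_sum G\<^sub>1 f\<^sub>1"] card_image_le[OF fin(2), of "vertex_sum G\<^sub>2 f\<^sub>2"]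
      f\<^sub>1(2) f\<^sub>2(2) G\<^sub>1(3) G\<^sub>2(3) assms(3,4) by linarith+
  moreover have "even p\<^sub>1 \<longleftrightarrow> even p\<^sub>2"
    using assms(16) by (simp add: cong_def even_iff_mod_2_eq_zero)
  ultimately obtain g where bij: "bij_betw g (edges ?G) {1..card (edges ?G)}"
    and s\<^sub>1: "\<And>u. u \<in> verts G\<^sub>1 \<Longrightarrow> 2 * ?s g u = 2 * vertex_sum G\<^sub>1 f\<^sub>1 u + 2 * r\<^sub>1 * K + p\<^sub>2 * (K + 1)"
    and s\<^sub>2: "\<And>v. v \<in> verts G\<^sub>2 \<Longrightarrow> 2 * ?s g v =
      2 * vertex_sum G\<^sub>2 f\<^sub>2 v + 2 * r\<^sub>2 * (K + ?q) + p\<^sub>1 * (K + 1)"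
    using join_labeling[OF G\<^sub>1(1,2) G\<^sub>2(1,2) assms(13) f\<^sub>1(1) f\<^sub>2(1)]
    unfolding G\<^sub>1(3) G\<^sub>2(3) K_def by blast
  have cross: "?s g u \<noteq> ?s g v" if u: "u \<in> verts G\<^sub>1" and v: "v \<in> verts G\<^sub>2" for u v
  proof
    \<comment> \<open>The doubled sums are equated and the factor \<open>2 * ?q\<close> is isolated,
      so that \<open>handshake\<close> turns it into \<open>p\<^sub>1 * r\<^sub>1\<close>. Solving
      over the reals, where subtraction and halving are exact, yields precisely the excluded
      value.\<close>
    assume "?s g u = ?s g v"
    then have "2 * vertex_sum G\<^sub>1 f\<^sub>1 u + 2 * r\<^sub>1 * K + p\<^sub>2 * (K + 1)
        = 2 * vertex_sum G\<^sub>2 f\<^sub>2 v + 2 * r\<^sub>2 * K + r\<^sub>2 * (2 * ?q) + p\<^sub>1 * (K + 1)"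
      using s\<^sub>1[OF u] s\<^sub>2[OF v] by (simp add: algebra_simps)
    then have "2 * vertex_sum G\<^sub>1 f\<^sub>1 u + 2 * r\<^sub>1 * K + p\<^sub>2 * (K + 1)
        = 2 * vertex_sum G\<^sub>2 f\<^sub>2 v + 2 * r\<^sub>2 * K + r\<^sub>2 * (p\<^sub>1 * r\<^sub>1) + p\<^sub>1 * (K + 1)"
      using handshake[OF G\<^sub>1(1,2)] G\<^sub>1(3) by simp
    then have "real (2 * vertex_sum G\<^sub>1 f\<^sub>1 u + 2 * r\<^sub>1 * K + p\<^sub>2 * (K + 1))
        = real (2 * vertex_sum G\<^sub>2 f\<^sub>2 v + 2 * r\<^sub>2 * K + r\<^sub>2 * (p\<^sub>1 * r\<^sub>1) + p\<^sub>1 * (K + 1))"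
      by (simp only:)
    then have "real (vertex_sum G\<^sub>2 f\<^sub>2 v) - real (vertex_sum G\<^sub>1 f\<^sub>1 u) =
             (real p\<^sub>2 - real p\<^sub>1) * (real p\<^sub>1 * real p\<^sub>2 + 1) / 2
             + (real r\<^sub>1 - real r\<^sub>2) * real p\<^sub>1 * real p\<^sub>2
             - real p\<^sub>1 * real r\<^sub>1 * real r\<^sub>2 / 2"
      by (simp add: K_def field_simps)
    then show False using assms(17) u v by blast
  qed
  have "?s g u \<noteq> ?s g v" if uv: "{u, v} \<in> edges ?G" for u v
  proof -
    consider "{u, v} \<in> edges G\<^sub>1" | "{u, v} \<in> edges G\<^sub>2" | "u \<in> verts G\<^sub>1" "v \<in> verts G\<^sub>2"
      | "v \<in> verts G\<^sub>1" "u \<in> verts G\<^sub>2"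
      using uv by (auto simp: join_def doubleton_eq_iff)
    then show ?thesis
    proof cases
      case 1
      then have "u \<in> verts G\<^sub>1" "v \<in> verts G\<^sub>1" using G\<^sub>1(1) by (auto simp: simple_graph_def)
      then show ?thesis using f\<^sub>1(3)[OF 1] s\<^sub>1[of u] s\<^sub>1[of v] by auto
    next
      case 2
      then have "u \<in> verts G\<^sub>2" "v \<in> verts G\<^sub>2" using G\<^sub>2(1) by (auto simp: simple_graph_def)
      then show ?thesis using f\<^sub>2(3)[OF 2] s\<^sub>2[of u] s\<^sub>2[of v] by auto
    next
      case 3
      then show ?thesis by (rule cross)
    next
      case 4
      then show ?thesis using cross[of v u] by simp
    qed
  qed
  then have lab: "local_antimagic_labeling ?G g"
    using bij by (simp add: local_antimagic_labeling_def)
  have "num_colors ?G g \<le> t\<^sub>1 + t\<^sub>2"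
  proof -
    have "num_colors ?G g \<le> card (?s g ` verts G\<^sub>1) + card (?s g ` verts G\<^sub>2)"
      using card_Un_le[of "?s g ` verts G\<^sub>1" "?s g ` verts G\<^sub>2"]
      by (simp add: num_colors_def join_def image_Un)
    moreover have "card (?s g ` verts G\<^sub>1) \<le> t\<^sub>1"
      using card_image_le_of_shift[OF fin(1), of "?s g" "vertex_sum G\<^sub>1 f\<^sub>1" "2 * r\<^sub>1 * K + p\<^sub>2 * (K + 1)"]
        s\<^sub>1 f\<^sub>1(2) by simp
    moreover have "card (?s g ` verts G\<^sub>2) \<le> t\<^sub>2"
      using card_image_le_of_shift[OF fin(2), of "?s g" "vertex_sum G\<^sub>2 f\<^sub>2"
          "2 * r\<^sub>2 * (K + ?q) + p\<^sub>1 * (K + 1)"] s\<^sub>2 f\<^sub>2(2) by simp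
    ultimately show ?thesis by linarith
  qed
  then have upper: "\<chi>\<^sub>l\<^sub>a ?G \<le> enat (t\<^sub>1 + t\<^sub>2)"
    unfolding local_antimagic_chromatic_number_def using lab by (intro INF_lower2[of g]) auto
  \<comment> \<open>The bound holds for every local antimagic labeling of the join, hence for the
    infimum.\<close>
  have "enat (\<chi> G\<^sub>1 + \<chi> G\<^sub>2) \<le> \<chi>\<^sub>l\<^sub>a ?G"
    unfolding local_antimagic_chromatic_number_def
    using chromatic_number_join_le_num_colors[OF G\<^sub>1(1) G\<^sub>2(1)] by (intro INF_greatest) simp
  with upper show ?thesis by auto
qed
end
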